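(* Let $n\ge 3$. For positive integers $s,t$ let $f(n,s,t)$ be the maximum size of an $(s,t)$-union-intersecting system of subsets of $[n]$. Then: (a) $f(n,1,1)=2^{n-1}$. (b) $$f(n,1,2)=\begin{cases}\displaystyle\sum_{i=n/2}^{n}\binom{n}{i} & \text{if } n \text{ is even},\\[2mm] \displaystyle\binom{n-1}{\frac{n-3}{2}}+\sum_{i=(n+1)/2}^{n}\binom{n}{i} & \text{if } n\text{ is odd}.\end{cases}$$ (c) $$f(n,2,2)=\begin{cases}\displaystyle\sum_{i=(n-1)/2}^{n}\binom{n}{i} & \text{if } n \text{ is odd},\\[2mm] \displaystyle\binom{n-1}{\frac{n}{2}-2}+\sum_{i=n/2}^{n}\binom{n}{i} & \text{if } n\text{ is even}.\end{cases}$$ (d) $$f(n,1,3)=\begin{cases}\displaystyle\sum_{i=n/2}^{n}\binom{n}{i} & \text{if } n \text{ is even},\\[2mm] \displaystyle\binom{n-1}{\frac{n-1}{2}}+\sum_{i=(n+1)/2}^{n}\binom{n}{i} & \text{if } n\text{ is odd}.\end{cases}$$ (e) If $t\ge 4$, then $$2^{n-1}+\frac12\binom{n}{\lfloor n/2\rfloor}\le f(n,1,t)\le 2^{n-1}+\binom{n}{\lfloor n/2\rfloor}\left(\frac12+\frac{t-2}{n}+O(n^{-2})\right).$$ (f) If $s\ge 2$ and $t\ge 3$, then $$2^{n-1}+\binom{n}{\lfloor n/2\rfloor}\frac{n}{n+2}\le f(n,s,t)\le 2^{n-1}+\binom{n}{\lfloor n/2\rfloor}\left(1+\frac{t+s-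3}{n}+O(n^{-2})\right).$$
   Context: $[n]=\{1,2,\dots,n\}$. A set system is a family of distinct sets. A set system $\mathcal{F}$ is called $(s,t)$-union-intersecting if for all $s+t$ pairwise different sets $F_1,\dots,F_s,G_1,\dots,G_t\in\mathcal{F}$, $$\left(\bigcup_{i=1}^s F_i\right)\cap\left(\bigcup_{j=1}^t G_j\right)\ne\emptyset.$$ In (e) and (f), $s$ and $t$ are fixed and $O(n^{-2})$ refers to $n\to\infty$; the implied constants may depend on $s$ and $t$ but not on $n$. *)

theory Defs
  imports Complex_Main "HOL-Library.Landau_Symbols"
begin

text \<open>The members \<open>A i\<close> and \<open>B j\<close> are pairwise different as sets: within each of the two
  groups by injectivity, across the groups by disjointness of the images.
  The condition is vacuous for a system with fewer than \<open>s + t\<close> members.\<close>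

definition union_intersecting :: "nat \<Rightarrow> nat \<Rightarrow> 'a set set \<Rightarrow> bool" where
  "union_intersecting s t \<F> \<longleftrightarrow>
     (\<forall>A B :: nat \<Rightarrow> 'a set.
        A ` {1..s} \<subseteq> \<F> \<and> B ` {1..t} \<subseteq> \<F> \<and>
        inj_on A {1..s} \<and> inj_on B {1..t} \<and> A ` {1..s} \<inter> B ` {1..t} = {} \<longrightarrow>
        (\<Union>i\<in>{1..s}. A i) \<inter> (\<Union>j\<in>{1..t}. B j) \<noteq> {})"

definition max_union_intersecting :: "nat \<Rightarrow> nat \<Rightarrow> nat \<Rightarrow> nat" where
  "max_union_intersecting n s t =
     Max (card ` {\<F>. \<F> \<subseteq> Pow {1..n} \<and> union_intersecting s t \<F>})"

end

(*
  Let G consist of the members of F whose complement is also in F; then 2|F| <= 2^n + |G|.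
  Disjointness A \<inter> B = {} means A \<subseteq> - B, so being (s,t)-union-intersecting becomes a condition on
  inclusions: a nonempty proper C in G cannot have s - 1 members of G below it and t - 1 above it.

  For (1,t), and for (s,t) after splitting G into two parts, this bounds the number of members below
  each member.  Counting members of G and comparable pairs on a random maximal chain (at most one
  more member than pairs) gives a LYM inequality with an error term, hence the asymptotic bounds, and
  the exact bound for (1,3), where the comparable pairs form a matching.

  For (1,2) with n odd and (2,2) with n even the closure of G under complement is needed.  Put the
  ground set on a circle in random order and count arcs in G.  With at most r arcs per starting point
  there are at most r n of them, and their number is even.  For r = 1 this saves one arc when n is
  odd.  For r = 2 and 2n arcs, both end points advance by exactly one with the starting point, so
  only two complementary lengths occur, and neither is n/2.
*)

theory Submission
  imports Defs "HOL-Combinatorics.Multiset_Permutations" "HOL-Real_Asymp.Real_Asymp"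
begin

section \<open>Union-intersecting systems and maximal chains\<close>

text \<open>A maximal chain never contains a nonempty proper set together with its complement, so
  counting on chains cannot use that the core is closed under complement. On a circle the complement
  of an arc is again an arc; this is why two of the exact bounds need circles. Both models come from
  permutations: the prefixes of a list form a maximal chain, and the prefixes of its rotations are
  the arcs. On a random maximal chain, a pair of a nonempty set and a proper superset
  \<open>B\<close> occurs with probability at most 1/|B| times that of \<open>B\<close> itself,
  which is the source of the terms of order 1/n. The corrected weight of a level need not be least
  in the middle when very small sets are allowed, so the asymptotic bound first discards sets with
  fewer than \<open>3 * \<rho>\<close> elements, where \<open>\<rho>\<close> bounds the number of
  members below a member. There are only polynomially many of them. The empty set is disjoint from
  itself and could belong to both groups; it and the whole set are therefore removed from the core.
  The exact bounds cannot afford this loss and treat systems containing the empty set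
  separately.\<close>

lemma union_intersecting_iff:
  "union_intersecting s t F \<longleftrightarrow>
     (\<forall>X Y. X \<subseteq> F \<and> Y \<subseteq> F \<and> finite X \<and> finite Y \<and> card X = s \<and> card Y = t \<and> X \<inter> Y = {}
        \<longrightarrow> \<Union>X \<inter> \<Union>Y \<noteq> {})" (is "?L \<longleftrightarrow> ?R")
proof
  assume L: ?L
  show ?R
  proof (intro allI impI)
    fix X Y
    assume *: "X \<subseteq> F \<and> Y \<subseteq> F \<and> finite X \<and> finite Y \<and> card X = s \<and> card Y = t \<and> X \<inter> Y = {}"
    obtain A B where A: "bij_betw A {1..s} X" and B: "bij_betw B {1..t} Y"
      using * ex_bij_betw_nat_finite_1 by metis
    then have "A ` {1..s} = X" "B ` {1..t} = Y" "inj_on A {1..s}" "inj_on B {1..t}"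
      by (auto simp: bij_betw_def)
    then show "\<Union>X \<inter> \<Union>Y \<noteq> {}"
      using L * unfolding union_intersecting_def by metis
  qed
next
  assume R: ?R
  show ?L
    unfolding union_intersecting_def
  proof (intro allI impI)
    fix A B :: "nat \<Rightarrow> 'a set"
    assume *: "A ` {1..s} \<subseteq> F \<and> B ` {1..t} \<subseteq> F \<and> inj_on A {1..s} \<and> inj_on B {1..t}
      \<and> A ` {1..s} \<inter> B ` {1..t} = {}"
    then have "card (A ` {1..s}) = s" "card (B ` {1..t}) = t"
      by (auto simp: card_image)
    with * show "(\<Union>i\<in>{1..s}. A i) \<inter> (\<Union>j\<in>{1..t}. B j) \<noteq> {}"
      by (intro R[rule_format]) auto
  qed
qed

text \<open>Here \<open>s\<close> and \<open>t\<close> are only lower bounds on the sizes, since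
  subfamilies of the exact sizes already meet. Families built from the core are used in this
  form.\<close>

lemma union_intersectingD:
  assumes "union_intersecting s t F" "X \<subseteq> F" "Y \<subseteq> F" "finite X" "finite Y"
    "s \<le> card X" "t \<le> card Y" "X \<inter> Y = {}"
  shows "\<exists>A\<in>X. \<exists>B\<in>Y. A \<inter> B \<noteq> {}"
proof -
  obtain X' Y' where "X' \<subseteq> X" "card X' = s" "finite X'" "Y' \<subseteq> Y" "card Y' = t" "finite Y'"
    using assms obtain_subset_with_card_n by metis
  moreover from this have "X' \<inter> Y' = {}" "X' \<subseteq> F" "Y' \<subseteq> F"
    using assms by auto
  ultimately have "\<Union>X' \<inter> \<Union>Y' \<noteq> {}"
    using assms(1) unfolding union_intersecting_iff by blast
  then show ?thesis
    using \<open>X' \<subseteq> X\<close> \<open>Y' \<subseteq> Y\<close> by blast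
qed

lemma union_intersecting_mono:
  assumes "union_intersecting s t F" "s \<le> s'" "t \<le> t'" "G \<subseteq> F"
  shows "union_intersecting s' t' G"
  unfolding union_intersecting_iff
proof (intro allI impI)
  fix X Y
  assume *: "X \<subseteq> G \<and> Y \<subseteq> G \<and> finite X \<and> finite Y \<and> card X = s' \<and> card Y = t' \<and> X \<inter> Y = {}"
  have "\<exists>A\<in>X. \<exists>B\<in>Y. A \<inter> B \<noteq> {}"
    by (rule union_intersectingD[OF assms(1)]) (use * assms in auto)
  then show "\<Union>X \<inter> \<Union>Y \<noteq> {}"
    by blast
qed

text \<open>Positivity of \<open>s\<close> makes the empty system admissible, so that the maximum is over a
  nonempty set.\<close>

lemma max_union_intersecting_attained:
  assumes "s > 0"
  obtains F where "F \<subseteq> Pow {1..n}" "union_intersecting s t F" "card F = max_union_intersecting n s t"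
proof -
  let ?S = "{F. F \<subseteq> Pow {1..n} \<and> union_intersecting s t F}"
  have "finite ?S"
    by (rule finite_subset[of _ "Pow (Pow {1..n})"]) auto
  moreover have "{} \<in> ?S"
    using assms by (auto simp: union_intersecting_iff)
  ultimately have "max_union_intersecting n s t \<in> card ` ?S"
    unfolding max_union_intersecting_def by (intro Max_in) auto
  then show ?thesis
    using that by auto
qed

lemma max_union_intersecting_le:
  assumes "s > 0"
    and "\<And>F. F \<subseteq> Pow {1..n} \<Longrightarrow> union_intersecting s t F \<Longrightarrow> card F \<le> K"
  shows "max_union_intersecting n s t \<le> K"
  using max_union_intersecting_attained[OF assms(1), of n t] assms(2) by metis

lemma max_union_intersecting_ge:
  assumes "F \<subseteq> Pow {1..n}" "union_intersecting s t F"
  shows "card F \<le> max_union_intersecting n s t"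
proof -
  let ?S = "{F. F \<subseteq> Pow {1..n} \<and> union_intersecting s t F}"
  have "finite ?S"
    by (rule finite_subset[of _ "Pow (Pow {1..n})"]) auto
  then show ?thesis
    unfolding max_union_intersecting_def using assms by (intro Max_ge) auto
qed

lemma max_union_intersecting_mono:
  assumes "s > 0" "s \<le> s'" "t \<le> t'"
  shows "max_union_intersecting n s t \<le> max_union_intersecting n s' t'"
proof (rule max_union_intersecting_le[OF assms(1)])
  fix F assume "F \<subseteq> Pow {1..n}" "union_intersecting s t F"
  then show "card F \<le> max_union_intersecting n s' t'"
    by (intro max_union_intersecting_ge union_intersecting_mono[OF _ assms(2,3) order_refl])
qed

section \<open>Members whose complement is also a member\<close>

definition compl_core :: "'a set \<Rightarrow> 'a set set \<Rightarrow> 'a set set" where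
  "compl_core S F = {A \<in> F. S - A \<in> F}"

lemma compl_core_subset: "compl_core S F \<subseteq> F"
  by (auto simp: compl_core_def)

lemma compl_core_compl:
  assumes "F \<subseteq> Pow S" "A \<in> compl_core S F"
  shows "S - A \<in> compl_core S F"
proof -
  have "S - (S - A) = A"
    using assms by (auto simp: compl_core_def)
  then show ?thesis
    using assms by (auto simp: compl_core_def)
qed

text \<open>\<open>F\<close> and the family of complements of its members have equal size and meet
  exactly in the core, and their union lies in \<open>Pow S\<close>.\<close>

lemma card_le_compl_core:
  assumes "finite S" "F \<subseteq> Pow S"
  shows "2 * card F \<le> 2 ^ card S + card (compl_core S F)"
proof -
  let ?c = "\<lambda>A. S - A"
  have fin: "finite F"
    using assms finite_subset by blast
  have "inj_on ?c F"
    using assms(2) by (intro inj_onI) blast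
  then have "card (?c ` F) = card F"
    by (rule card_image)
  moreover have "compl_core S F = F \<inter> ?c ` F"
  proof -
    have "S - (S - A) = A" if "A \<in> F" for A
      using that assms(2) by auto
    then show ?thesis
      unfolding compl_core_def by (auto simp: image_iff)
  qed
  moreover have "card (F \<union> ?c ` F) \<le> card (Pow S)"
    using assms by (intro card_mono) auto
  ultimately show ?thesis
    using card_Un_Int[of F "?c ` F"] fin assms(1) by (simp add: card_Pow)
qed

section \<open>Permutations through given sets and a LYM inequality\<close>

text \<open>Such a permutation is a concatenation of orderings of \<open>A\<close>,
  \<open>B - A\<close> and \<open>S - B\<close>. The case \<open>A = B\<close> counts the
  permutations through a single set.\<close>

lemma card_permutations_with_prefixes:
  assumes "finite S" "A \<subseteq> B" "B \<subseteq> S"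
  shows "card {xs \<in> permutations_of_set S. set (take (card A) xs) = A \<and> set (take (card B) xs) = B}
           = fact (card A) * fact (card B - card A) * fact (card S - card B)"
proof -
  let ?P = "permutations_of_set"
  let ?f = "\<lambda>(xs, ys, zs). xs @ ys @ zs"
  let ?D = "?P A \<times> ?P (B - A) \<times> ?P (S - B)"
  have fin: "finite B" "finite A"
    using assms by (auto intro: finite_subset)
  have len: "length xs = card X" if "xs \<in> ?P X" for xs and X :: "'a set"
    using that by (rule length_finite_permutations_of_set)
  have inj: "inj_on ?f ?D"
  proof (rule inj_onI)
    fix p q assume *: "p \<in> ?D" "q \<in> ?D" "?f p = ?f q"
    obtain xs ys zs xs' ys' zs' where pq: "p = (xs, ys, zs)" "q = (xs', ys', zs')"
      by (metis prod.exhaust)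
    have "length xs = length xs'" "length ys = length ys'"
      using * pq len[of xs A] len[of xs' A] len[of ys "B - A"] len[of ys' "B - A"] by auto
    then show "p = q"
      using * pq by simp
  qed
  have img: "?f ` ?D = {xs \<in> ?P S. set (take (card A) xs) = A \<and> set (take (card B) xs) = B}"
    (is "_ = ?R")
  proof (intro equalityI subsetI)
    fix us assume "us \<in> ?f ` ?D"
    then obtain xs ys zs where us: "us = xs @ ys @ zs" "xs \<in> ?P A" "ys \<in> ?P (B - A)" "zs \<in> ?P (S - B)"
      by auto
    have 1: "length xs = card A" "length ys = card B - card A"
      using us len by (auto simp: card_Diff_subset fin assms)
    have 2: "set xs = A" "set ys = B - A" "set zs = S - B" "distinct xs" "distinct ys" "distinct zs"
      using us by (auto dest: permutations_of_setD)
    have "card A \<le> card B"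
      using fin assms by (intro card_mono) auto
    then show "us \<in> ?R"
      using 1 2 us(1) assms(2,3) by (intro CollectI conjI permutations_of_setI) auto
  next
    fix us assume us: "us \<in> ?R"
    let ?a = "card A" and ?b = "card B"
    have ab: "?a \<le> ?b"
      using fin assms by (intro card_mono) auto
    define xs where "xs = take ?a us"
    define ys where "ys = drop ?a (take ?b us)"
    define zs where "zs = drop ?b us"
    have dist: "distinct us" "set us = S"
      using us by (auto dest: permutations_of_setD)
    have tb: "take ?b us = xs @ ys"
      unfolding xs_def ys_def using ab
      by (metis append_take_drop_id min.absorb1 take_take)
    have eq: "us = xs @ ys @ zs"
      using tb unfolding zs_def by (metis append.assoc append_take_drop_id)
    have sx: "set xs = A" "set (xs @ ys) = B"
      using us tb by (auto simp: xs_def)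
    have "xs \<in> ?P A"
      using dist eq sx by (intro permutations_of_setI) auto
    moreover have "ys \<in> ?P (B - A)"
      using dist eq sx by (intro permutations_of_setI) auto
    moreover have "zs \<in> ?P (S - B)"
      using dist eq sx by (intro permutations_of_setI) auto
    ultimately show "us \<in> ?f ` ?D"
      using eq by force
  qed
  have "card ?R = card ?D"
    using card_image[OF inj] unfolding img .
  also have "\<dots> = card (?P A) * card (?P (B - A)) * card (?P (S - B))"
    by (simp only: card_cartesian_product mult.assoc)
  also have "\<dots> = fact (card A) * fact (card B - card A) * fact (card S - card B)"
    using assms fin by (simp only: card_permutations_of_set finite_Diff card_Diff_subset)
  finally show ?thesis .
qed

lemma card_permutations_with_prefix:
  assumes "finite S" "A \<subseteq> S"
  shows "card {xs \<in> permutations_of_set S. set (take (card A) xs) = A} = fact (card A) * fact (card S - card A)"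
  using card_permutations_with_prefixes[OF assms(1) subset_refl assms(2)] by simp

text \<open>A minimal member of a nonempty chain lies below all the others, and these pairs alone
  suffice.\<close>

lemma card_chain_le:
  assumes "finite X" and chain: "\<And>A B. A \<in> X \<Longrightarrow> B \<in> X \<Longrightarrow> A \<subseteq> B \<or> B \<subseteq> A"
  shows "card X \<le> 1 + card {(A, B). A \<in> X \<and> B \<in> X \<and> A \<subset> B}"
proof (cases "X = {}")
  case False
  then obtain M where M: "M \<in> X" "\<And>B. B \<in> X \<Longrightarrow> \<not> B \<subset> M"
    using finite_has_minimal[OF assms(1)] by (metis psubset_eq)
  then have "Pair M ` (X - {M}) \<subseteq> {(A, B). A \<in> X \<and> B \<in> X \<and> A \<subset> B}"
    using chain by blast
  moreover have "finite {(A, B). A \<in> X \<and> B \<in> X \<and> A \<subset> B}"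
    by (rule finite_subset[of _ "X \<times> X"]) (use assms(1) in auto)
  ultimately have "card (Pair M ` (X - {M})) \<le> card {(A, B). A \<in> X \<and> B \<in> X \<and> A \<subset> B}"
    by (intro card_mono)
  moreover have "card (Pair M ` (X - {M})) = card X - 1"
    using M(1) by (subst card_image) (auto intro: inj_onI)
  ultimately show ?thesis
    by linarith
qed auto

lemma sum_card_filter_swap:
  assumes "finite P" "finite H"
  shows "(\<Sum>x\<in>P. card {A \<in> H. R x A}) = (\<Sum>A\<in>H. card {x \<in> P. R x A})"
  by (rule sum_multicount_gen[OF assms]) simp

text \<open>A LYM inequality with a second-order Bonferroni correction: average \<open>card_chain_le\<close> over the
  maximal chains formed by the prefixes of a permutation.\<close>

lemma lym_with_pairs_nat:
  assumes "finite S" "H \<subseteq> Pow S"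
  defines "P \<equiv> {(A, B). A \<in> H \<and> B \<in> H \<and> A \<subset> B}"
  shows "(\<Sum>A\<in>H. fact (card A) * fact (card S - card A))
     \<le> fact (card S) + (\<Sum>(A, B)\<in>P. fact (card A) * fact (card B - card A) * fact (card S - card B) :: nat)"
proof -
  let ?\<Pi> = "permutations_of_set S"
  have finH: "finite H"
    using assms(1,2) by (meson finite_Pow_iff finite_subset)
  have finP: "finite P"
    by (rule finite_subset[of _ "H \<times> H"]) (use finH in \<open>auto simp: P_def\<close>)
  have "(\<Sum>A\<in>H. fact (card A) * fact (card S - card A))
      = (\<Sum>A\<in>H. card {xs \<in> ?\<Pi>. set (take (card A) xs) = A})"
    using assms by (intro sum.cong) (auto simp: card_permutations_with_prefix)
  also have "\<dots> = (\<Sum>xs\<in>?\<Pi>. card {A \<in> H. set (take (card A) xs) = A})"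
    using finH by (intro sum_card_filter_swap[symmetric]) auto
  also have "\<dots> \<le> (\<Sum>xs\<in>?\<Pi>. 1 + card {p \<in> P. set (take (card (fst p)) xs) = fst p
                                          \<and> set (take (card (snd p)) xs) = snd p})"
  proof (rule sum_mono)
    fix xs assume "xs \<in> ?\<Pi>"
    let ?X = "{A \<in> H. set (take (card A) xs) = A}"
    have "card ?X \<le> 1 + card {(A, B). A \<in> ?X \<and> B \<in> ?X \<and> A \<subset> B}"
    proof (rule card_chain_le)
      fix A B assume "A \<in> ?X" "B \<in> ?X"
      then show "A \<subseteq> B \<or> B \<subseteq> A"
        by (metis (mono_tags, lifting) mem_Collect_eq nle_le set_take_subset_set_take)
    qed (use finH in auto)
    also have "{(A, B). A \<in> ?X \<and> B \<in> ?X \<and> A \<subset> B}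
      = {p \<in> P. set (take (card (fst p)) xs) = fst p \<and> set (take (card (snd p)) xs) = snd p}"
      by (auto simp: P_def)
    finally show "card ?X \<le> 1 + card {p \<in> P. set (take (card (fst p)) xs) = fst p
                                          \<and> set (take (card (snd p)) xs) = snd p}" .
  qed
  also have "\<dots> = fact (card S) + (\<Sum>xs\<in>?\<Pi>. card {p \<in> P. set (take (card (fst p)) xs) = fst p
                                          \<and> set (take (card (snd p)) xs) = snd p})"
    using assms by (simp only: sum.distrib) simp
  also have "(\<Sum>xs\<in>?\<Pi>. card {p \<in> P. set (take (card (fst p)) xs) = fst p
                                          \<and> set (take (card (snd p)) xs) = snd p})
     = (\<Sum>p\<in>P. card {xs \<in> ?\<Pi>. set (take (card (fst p)) xs) = fst p
                                          \<and> set (take (card (snd p)) xs) = snd p})"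
    using finP by (intro sum_card_filter_swap) auto
  also have "\<dots> = (\<Sum>(A, B)\<in>P. fact (card A) * fact (card B - card A) * fact (card S - card B))"
    using assms(1,2) by (intro sum.cong) (auto simp: P_def intro!: card_permutations_with_prefixes)
  finally show ?thesis .
qed

text \<open>The left side is the probability that a random maximal chain passes through two given
  nested sets of sizes \<open>a\<close> and \<open>b\<close>. The right side computes it as hitting
  the larger set and then, inside it, the smaller one.\<close>

lemma inverse_binomial_pair:
  assumes "a \<le> b" "b \<le> n"
  shows "real (fact a * fact (b - a) * fact (n - b)) / fact n = 1 / ((n choose b) * (b choose a))"
proof -
  have "real (n choose b) = fact n / (fact b * fact (n - b))" "real (b choose a) = fact b / (fact a * fact (b - a))"
    using binomial_fact[of b n] binomial_fact[of a b] assms by simp_all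
  then show ?thesis
    by simp
qed

lemma lym_with_pairs:
  assumes "finite S" "H \<subseteq> Pow S" "card S = n"
  defines "P \<equiv> {(A, B). A \<in> H \<and> B \<in> H \<and> A \<subset> B}"
  shows "(\<Sum>A\<in>H. 1 / real (n choose card A))
     \<le> 1 + (\<Sum>(A, B)\<in>P. 1 / (real (n choose card B) * real (card B choose card A)))"
proof -
  let ?l = "\<lambda>A. fact (card A) * fact (card S - card A) :: nat"
  let ?r = "\<lambda>(A, B). fact (card A) * fact (card B - card A) * fact (card S - card B) :: nat"
  have card_le: "card A \<le> n" if "A \<in> H" for A
    using that assms by (metis PowD card_mono subset_iff)
  have "real (\<Sum>A\<in>H. ?l A) \<le> real (fact (card S) + (\<Sum>p\<in>P. ?r p))"
    unfolding of_nat_le_iff P_def by (rule lym_with_pairs_nat[OF assms(1,2)])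
  then have "real (\<Sum>A\<in>H. ?l A) / fact n \<le> real (fact (card S) + (\<Sum>p\<in>P. ?r p)) / fact n"
    by (rule divide_right_mono) simp
  then have "(\<Sum>A\<in>H. real (?l A) / fact n) \<le> 1 + (\<Sum>p\<in>P. real (?r p) / fact n)"
    by (simp add: add_divide_distrib sum_divide_distrib assms(3))
  also have "(\<Sum>A\<in>H. real (?l A) / fact n) = (\<Sum>A\<in>H. 1 / real (n choose card A))"
    using card_le binomial_fact[of _ n, where 'a = real] by (intro sum.cong) (simp_all add: assms(3))
  also have "(\<Sum>p\<in>P. real (?r p) / fact n)
     = (\<Sum>(A, B)\<in>P. 1 / (real (n choose card B) * real (card B choose card A)))"
  proof (rule sum.cong)
    fix p assume "p \<in> P"
    then obtain A B where p: "p = (A, B)" "A \<in> H" "B \<in> H" "A \<subset> B"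
      by (auto simp: P_def)
    then have "finite B"
      using assms finite_subset by (metis PowD subset_iff)
    then have "card A \<le> card B"
      using p by (intro card_mono) auto
    then show "real (?r p) / fact n = (case p of (A, B) \<Rightarrow> 1 / (real (n choose card B) * real (card B choose card A)))"
      using p card_le[of B] inverse_binomial_pair[of "card A" "card B" n] by (simp add: assms(3))
  qed simp
  finally show ?thesis .
qed

section \<open>Families with few comparable pairs\<close>

text \<open>Absorption turns the left side into \<open>n * ((n - 1) choose b)\<close>, and
  \<open>n div 2\<close> is a middle index of row \<open>n - 1\<close> for either parity of
  \<open>n\<close>.\<close>

lemma binomial_times_complement_le:
  "(n choose b) * (n - b) \<le> (n choose (n div 2)) * (n - n div 2)"
proof (cases "n = 0")
  case False
  have eq: "(n - 1) choose ((n - 1) div 2) = (n - 1) choose (n div 2)"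
  proof (cases "even n")
    case True
    with False have "n - 1 - n div 2 = (n - 1) div 2"
      by (auto elim!: evenE)
    then show ?thesis
      using binomial_symmetric[of "n div 2" "n - 1"] False True by (auto elim!: evenE)
  qed (auto elim!: oddE)
  have "(n choose b) * (n - b) = n * ((n - 1) choose b)" for b
    using binomial_absorb_comp[of n b] by (simp add: mult.commute)
  then show ?thesis
    using binomial_maximum[of "n - 1" b] eq by simp
qed auto

text \<open>From the middle upwards both factors are at least their middle values. Below the middle
  the correction \<open>1 - \<rho> / b\<close> gets smaller, but the binomial coefficient shrinks at
  least by the ratio \<open>h / (n - b)\<close>, and this outweighs the loss as long as
  \<open>3 * \<rho> \<le> b\<close>.\<close>

lemma corrected_weight_ge:
  fixes \<rho> b n :: nat
  assumes "b \<le> n" "3 * \<rho> \<le> b" "n \<ge> 2"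
  shows "(1 - real \<rho> / real (n div 2)) / real (n choose (n div 2)) \<le> (1 - real \<rho> / real b) / real (n choose b)"
proof -
  define k where "k = n div 2"
  define h where "h = n - k"
  define M where "M = n choose k"
  define C where "C = n choose b"
  have k: "k \<ge> 1" "k \<le> h" "h \<le> 2 * k" "n = h + k"
    using assms(3) by (auto simp: k_def h_def)
  have C: "C > 0" "M > 0" "C \<le> M"
    using assms(1) binomial_maximum[of n b] unfolding C_def M_def k_def by simp_all
  show ?thesis
  proof (cases "b \<ge> k")
    case True
    have "real \<rho> / real b \<le> real \<rho> / real k"
      using True k by (intro divide_left_mono) auto
    moreover have "real \<rho> / real b \<le> 1"
      using assms(2) by (cases "b = 0") (auto simp: divide_le_eq)
    ultimately have "(1 - real \<rho> / real k) / real M \<le> (1 - real \<rho> / real b) / real M" "(1 - real \<rho> / real b) / real M \<le> (1 - real \<rho> / real b) / real C"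
      using C by (auto intro!: divide_right_mono divide_left_mono)
    then show ?thesis
      by (simp add: k_def M_def C_def)
  next
    case False
    have "C * (n - b) \<le> M * h"
      unfolding C_def M_def h_def k_def by (rule binomial_times_complement_le)
    then have le: "real C * real (n - b) \<le> real M * real h"
      by (simp flip: of_nat_mult)
    have "(1 - real \<rho> / real k) * real h \<le> (1 - real \<rho> / real b) * real (n - b)"
    proof (cases "b = 0")
      case True
      then show ?thesis
        using assms(2) k by simp
    next
      case b: False
      \<comment> \<open>Origin of the constant 3: since \<open>h \<le> 2 * k\<close>, the sum
        \<open>h * \<rho> + k * \<rho>\<close> is at most \<open>3 * k * \<rho>\<close>, hence at
        most \<open>k * b\<close>.\<close>
      have "h * \<rho> \<le> 2 * k * \<rho>"
        using k by (intro mult_right_mono) auto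
      moreover have "k * (3 * \<rho>) \<le> k * b"
        using assms(2) by (intro mult_left_mono) auto
      moreover have "k * (3 * \<rho>) = 2 * k * \<rho> + k * \<rho>"
        by simp
      ultimately have "h * \<rho> + k * \<rho> \<le> k * b"
        by linarith
      then have "real h * real \<rho> + real k * real \<rho> \<le> real k * real b"
        by (metis of_nat_add of_nat_le_iff of_nat_mult)
      \<comment> \<open>After clearing denominators, the difference of the two sides of the claim
        factors as this product.\<close>
      then have "0 \<le> (real k - real b) * (real k * (real b - real \<rho>) - real h * real \<rho>)"
        using False by (intro mult_nonneg_nonneg) (auto simp: right_diff_distrib)
      also have "\<dots> = (real h + real k - real b) * (real b - real \<rho>) * real k - real h * real b * (real k - real \<rho>)"
        by (simp add: algebra_simps)
      finally have "(real k - real \<rho>) * real b * real h \<le> (real b - real \<rho>) * real k * (real h + real k - real b)"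
        by (simp add: algebra_simps)
      then show ?thesis
        using b k False by (simp add: field_simps of_nat_diff)
    qed
    moreover have "1 - real \<rho> / real b \<ge> 0"
      using assms(2) by (cases "b = 0") (auto simp: divide_le_eq)
    ultimately have "(1 - real \<rho> / real k) * real h * real C \<le> (1 - real \<rho> / real b) * real (n - b) * real C"
      by (intro mult_right_mono) auto
    also have "\<dots> \<le> (1 - real \<rho> / real b) * (real M * real h)"
      using mult_left_mono[OF le \<open>1 - real \<rho> / real b \<ge> 0\<close>] by (simp add: mult_ac)
    finally have "((1 - real \<rho> / real k) * real C) * real h \<le> ((1 - real \<rho> / real b) * real M) * real h"
      by (simp add: mult_ac)
    then have "(1 - real \<rho> / real k) * real C \<le> (1 - real \<rho> / real b) * real M"
      using k by simp
    then show ?thesis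
      using C by (simp add: field_simps flip: k_def M_def C_def)
  qed
qed

text \<open>By absorption \<open>b * (n choose b)\<close> is \<open>n\<close> times a binomial
  coefficient of row \<open>n - 1\<close>, and \<open>D\<close> is the largest one there. The bound
  is linear in \<open>b\<close>, so it adds up well with its mirror image below.\<close>

lemma inverse_central_binomial_le:
  assumes "b \<le> n" "n > 0"
  defines "D \<equiv> (n - 1) choose ((n - 1) div 2)"
  shows "real b / (real n * real D) \<le> 1 / real (n choose b)"
proof (cases "b = 0")
  case False
  have "b * (n choose b) \<le> n * D"
    using times_binomial_minus1_eq[of b n] binomial_maximum[of "n - 1" "b - 1"] False by (simp add: D_def)
  then have "real b * real (n choose b) \<le> real n * real D"
    by (metis of_nat_le_iff of_nat_mult)
  then show ?thesis
    using assms False by (simp add: divide_le_eq le_divide_eq D_def)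
qed auto

lemma inverse_central_binomial_le':
  assumes "b \<le> n" "n > 0"
  defines "D \<equiv> (n - 1) choose ((n - 1) div 2)"
  shows "(real n - real b) / (real n * real D) \<le> 1 / real (n choose b)"
  using inverse_central_binomial_le[of "n - b" n] binomial_symmetric[of b n] assms
  by (simp add: of_nat_diff)

text \<open>A member strictly inside \<open>B\<close> costs at most \<open>1 / card B\<close> times
  the weight of \<open>B\<close>. The LYM inequality thus bounds the sum of
  \<open>(1 - \<rho> / card B) / (n choose card B)\<close> by 1, and each summand is at least its
  value in the middle level.\<close>

lemma card_few_subsets_le:
  fixes \<rho> n :: nat
  assumes "finite S" "H \<subseteq> Pow S" "card S = n" "n \<ge> 2"
    and few: "\<And>B. B \<in> H \<Longrightarrow> card {A \<in> H. A \<subset> B} \<le> \<rho>"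
    and large: "\<And>B. B \<in> H \<Longrightarrow> 3 * \<rho> \<le> card B"
  shows "real (card H) * (1 - real \<rho> / real (n div 2)) \<le> real (n choose (n div 2))"
proof -
  define P where "P = {(A, B). A \<in> H \<and> B \<in> H \<and> A \<subset> B}"
  let ?w = "\<lambda>A. 1 / real (n choose card A)"
  let ?p = "\<lambda>A B. 1 / (real (n choose card B) * real (card B choose card A))"
  have finH: "finite H"
    using assms(1,2) by (meson finite_Pow_iff finite_subset)
  have sub: "B \<subseteq> S" "finite B" "card B \<le> n" if "B \<in> H" for B
    using that assms(1-3) by (auto intro: finite_subset card_mono)
  have "(\<Sum>(A, B)\<in>P. ?p A B) = (\<Sum>(B, A)\<in>Sigma H (\<lambda>B. {A \<in> H. A \<subset> B}). ?p A B)"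
    by (rule sum.reindex_bij_witness[of _ prod.swap prod.swap]) (auto simp: P_def)
  also have "\<dots> = (\<Sum>B\<in>H. \<Sum>A\<in>{A \<in> H. A \<subset> B}. ?p A B)"
    using finH by (intro sum.Sigma[symmetric]) auto
  also have "\<dots> \<le> (\<Sum>B\<in>H. real \<rho> / real (card B) * ?w B)"
  proof (rule sum_mono)
    fix B assume B: "B \<in> H"
    have "(\<Sum>A\<in>{A \<in> H. A \<subset> B}. ?p A B) \<le> real (card {A \<in> H. A \<subset> B}) * (1 / real (card B) * ?w B)"
    proof (rule sum_bounded_above)
      fix A assume A: "A \<in> {A \<in> H. A \<subset> B}"
      \<comment> \<open>The existence of \<open>A\<close> makes \<open>\<rho>\<close> positive, and
        then \<open>large\<close> makes \<open>A\<close> nonempty, so that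
        \<open>card B choose card A\<close> is at least \<open>card B\<close>.\<close>
      then have "card {A \<in> H. A \<subset> B} \<noteq> 0"
        using finH by auto
      then have "\<rho> \<noteq> 0"
        using few[OF B] by simp
      then have "card A > 0" "card A < card B"
        using large[of A] A sub[OF B] by (auto intro: psubset_card_mono)
      then have "card B \<le> card B choose card A"
        by (intro upper_le_binomial) auto
      then have "?p A B \<le> 1 / (real (n choose card B) * real (card B))"
        using \<open>card A < card B\<close> sub[OF B] by (intro divide_left_mono mult_left_mono) auto
      then show "?p A B \<le> 1 / real (card B) * ?w B"
        by (simp add: mult.commute)
    qed
    also have "\<dots> \<le> real \<rho> * (1 / real (card B) * ?w B)"
      using few[OF B] by (intro mult_right_mono) auto
    finally show "(\<Sum>A\<in>{A \<in> H. A \<subset> B}. ?p A B) \<le> real \<rho> / real (card B) * ?w B"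
      by simp
  qed
  finally have "(\<Sum>B\<in>H. ?w B) \<le> 1 + (\<Sum>B\<in>H. real \<rho> / real (card B) * ?w B)"
    using lym_with_pairs[OF assms(1-3)] unfolding P_def by linarith
  moreover have "(\<Sum>B\<in>H. (1 - real \<rho> / real (card B)) * ?w B) = (\<Sum>B\<in>H. ?w B) - (\<Sum>B\<in>H. real \<rho> / real (card B) * ?w B)"
    by (simp only: left_diff_distrib sum_subtractf mult_1)
  moreover have "(\<Sum>B\<in>H. (1 - real \<rho> / real (n div 2)) / real (n choose (n div 2))) \<le> (\<Sum>B\<in>H. (1 - real \<rho> / real (card B)) * ?w B)"
    using corrected_weight_ge[OF sub(3) large assms(4)] by (intro sum_mono) simp
  ultimately have "(\<Sum>B\<in>H. (1 - real \<rho> / real (n div 2)) / real (n choose (n div 2))) \<le> 1"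
    by linarith
  then have "real (card H) * (1 - real \<rho> / real (n div 2)) / real (n choose (n div 2)) \<le> 1"
    by simp
  moreover have "real (n choose (n div 2)) > 0"
    by simp
  ultimately show ?thesis
    by (simp add: divide_le_eq)
qed

lemma sperner:
  assumes "finite S" "H \<subseteq> Pow S" "card S = n" "n \<ge> 2"
    and "\<And>A B. A \<in> H \<Longrightarrow> B \<in> H \<Longrightarrow> \<not> A \<subset> B"
  shows "card H \<le> n choose (n div 2)"
proof -
  have "real (card H) * (1 - real 0 / real (n div 2)) \<le> real (n choose (n div 2))"
  proof (rule card_few_subsets_le[OF assms(1-4)])
    fix B assume "B \<in> H"
    then have "{A \<in> H. A \<subset> B} = {}"
      using assms(5) by blast
    then show "card {A \<in> H. A \<subset> B} \<le> 0"
      by (simp only: card.empty)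
  qed simp
  then show ?thesis
    by simp
qed

text \<open>The minimal members form an antichain, and so do the others: each of these lies above
  some member, so an inclusion between two of them would complete a chain of three.\<close>

lemma card_no_three_chain_le:
  assumes "finite S" "H \<subseteq> Pow S" "card S = n" "n \<ge> 2"
    and "\<And>A B C. A \<in> H \<Longrightarrow> B \<in> H \<Longrightarrow> C \<in> H \<Longrightarrow> A \<subset> B \<Longrightarrow> \<not> B \<subset> C"
  shows "card H \<le> 2 * (n choose (n div 2))"
proof -
  define H0 where "H0 = {A \<in> H. \<forall>B\<in>H. \<not> B \<subset> A}"
  have finH: "finite H"
    using assms(1,2) by (meson finite_Pow_iff finite_subset)
  have "card H0 \<le> n choose (n div 2)"
    by (rule sperner[OF assms(1) _ assms(3,4)]) (use assms(2) in \<open>auto simp: H0_def\<close>)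
  moreover have "card (H - H0) \<le> n choose (n div 2)"
  proof (rule sperner[OF assms(1) _ assms(3,4)])
    fix A B assume "A \<in> H - H0" "B \<in> H - H0"
    then show "\<not> A \<subset> B"
      using assms(5) unfolding H0_def by blast
  qed (use assms(2) in auto)
  moreover have "card H = card H0 + card (H - H0)"
    using finH card_mono[of H H0] by (subst card_Diff_subset) (auto simp: H0_def)
  ultimately show ?thesis
    by linarith
qed

text \<open>Each comparable pair is paid for by its own two ends. Its cost is at most the sum of
  their surpluses \<open>?g\<close>, the excess of the weight over \<open>1 / (2 * real D)\<close>,
  and different pairs have no end in common. Surpluses are nonnegative, so LYM leaves
  \<open>card H / (2 * real D) \<le> 1\<close>.\<close>

lemma card_matched_le:
  assumes "finite S" "H \<subseteq> Pow S" "card S = n" "n \<ge> 1" "{} \<notin> H"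
    and below: "\<And>A A' B. A \<in> H \<Longrightarrow> A' \<in> H \<Longrightarrow> B \<in> H \<Longrightarrow> A \<subset> B \<Longrightarrow> A' \<subset> B \<Longrightarrow> A = A'"
    and above: "\<And>A B B'. A \<in> H \<Longrightarrow> B \<in> H \<Longrightarrow> B' \<in> H \<Longrightarrow> A \<subset> B \<Longrightarrow> A \<subset> B' \<Longrightarrow> B = B'"
  shows "card H \<le> 2 * ((n - 1) choose ((n - 1) div 2))"
proof -
  define D where "D = (n - 1) choose ((n - 1) div 2)"
  define P where "P = {(A, B). A \<in> H \<and> B \<in> H \<and> A \<subset> B}"
  let ?w = "\<lambda>A. 1 / real (n choose card A)"
  let ?g = "\<lambda>A. ?w A - 1 / (2 * real D)"
  let ?p = "\<lambda>A B. 1 / (real (n choose card B) * real (card B choose card A))"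
  have finH: "finite H"
    using assms(1,2) by (meson finite_Pow_iff finite_subset)
  have sub: "B \<subseteq> S" "finite B" "card B \<le> n" if "B \<in> H" for B
    using that assms(1-3) by (auto intro: finite_subset card_mono)
  have finP: "finite P"
    by (rule finite_subset[of _ "H \<times> H"]) (use finH in \<open>auto simp: P_def\<close>)
  have D: "D > 0" and n: "n > 0"
    using assms(4) by (auto simp: D_def)
  have lower: "real (card A) / (real n * real D) \<le> ?w A" "(real n - real (card A)) / (real n * real D) \<le> ?w A" if "A \<in> H" for A
    using inverse_central_binomial_le inverse_central_binomial_le' sub(3)[OF that] n
    unfolding D_def by blast+
  have g0: "?g A \<ge> 0" if "A \<in> H" for A
  proof -
    have "real n / (real n * real D) \<le> 2 * ?w A"
      using lower[OF that] by (simp add: diff_divide_distrib)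
    then show ?thesis
      using n by (simp add: field_simps)
  qed
  \<comment> \<open>Equivalently, \<open>?w A + ?w B - ?p A B\<close> is at least
    \<open>1 / D\<close>. For sizes \<open>a < b\<close> the linear bounds give at least
    \<open>(n - a) + (b - 1)\<close>, divided by \<open>n * D\<close>.\<close>
  have pg: "?p A B \<le> ?g A + ?g B" if "(A, B) \<in> P" for A B
  proof -
    have AB: "A \<in> H" "B \<in> H" "A \<subset> B"
      using that by (auto simp: P_def)
    then have a: "card A < card B"
      using sub(2) by (intro psubset_card_mono) auto
    moreover have "card A > 0"
      using AB assms(5) sub(2) by (metis card_gt_0_iff)
    ultimately have "card B \<le> card B choose card A"
      by (intro upper_le_binomial) auto
    then have "?p A B \<le> 1 / (real (n choose card B) * real (card B))"
      using a sub[OF AB(2)] by (intro divide_left_mono mult_left_mono) auto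
    moreover have "?w B * (1 - 1 / real (card B)) = ?w B - 1 / (real (n choose card B) * real (card B))"
      by (simp add: right_diff_distrib)
    ultimately have "?w B - ?p A B \<ge> ?w B * (1 - 1 / real (card B))"
      by linarith
    moreover have "?w B * (1 - 1 / real (card B)) \<ge> real (card B) / (real n * real D) * (1 - 1 / real (card B))"
      using a by (intro mult_right_mono lower AB) auto
    moreover have "real (card B) / (real n * real D) * (1 - 1 / real (card B)) = (real (card B) - 1) / (real n * real D)"
      using a by (simp add: right_diff_distrib diff_divide_distrib)
    moreover have "real n / (real n * real D) \<le> (real (card B) - 1) / (real n * real D) + (real n - real (card A)) / (real n * real D)"
      unfolding add_divide_distrib[symmetric] using a by (intro divide_right_mono) auto
    moreover have "real n / (real n * real D) = 2 * (1 / (2 * real D))"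
      using n by simp
    ultimately show ?thesis
      using lower(2)[OF AB(1)] by linarith
  qed
  have "(\<Sum>A\<in>H. ?w A) \<le> 1 + (\<Sum>(A, B)\<in>P. ?p A B)"
    unfolding P_def by (rule lym_with_pairs[OF assms(1-3)])
  also have "(\<Sum>(A, B)\<in>P. ?p A B) \<le> (\<Sum>(A, B)\<in>P. ?g A + ?g B)"
    using pg by (intro sum_mono) auto
  also have "\<dots> = (\<Sum>p\<in>P. ?g (fst p)) + (\<Sum>p\<in>P. ?g (snd p))"
    by (simp add: sum.distrib[symmetric] case_prod_unfold)
  also have "(\<Sum>p\<in>P. ?g (fst p)) = (\<Sum>A\<in>fst ` P. ?g A)"
    using above by (subst sum.reindex) (auto simp: P_def inj_on_def)
  also have "(\<Sum>p\<in>P. ?g (snd p)) = (\<Sum>A\<in>snd ` P. ?g A)"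
    using below by (subst sum.reindex) (auto simp: P_def inj_on_def)
  also have "(\<Sum>A\<in>fst ` P. ?g A) + (\<Sum>A\<in>snd ` P. ?g A) = (\<Sum>A\<in>fst ` P \<union> snd ` P. ?g A)"
  proof (rule sum.union_disjoint[symmetric])
    \<comment> \<open>A set that is the upper end of one pair and the lower end of another would
      give a third set two members below it.\<close>
    show "fst ` P \<inter> snd ` P = {}"
    proof (rule ccontr)
      assume "fst ` P \<inter> snd ` P \<noteq> {}"
      then obtain A B C where "(A, B) \<in> P" "(B, C) \<in> P"
        by fastforce
      then show False
        using below[of A B C] unfolding P_def by blast
    qed
  qed (use finP in auto)
  also have "\<dots> \<le> (\<Sum>A\<in>H. ?g A)"
    using finH g0 by (intro sum_mono2) (auto simp: P_def)
  also have "\<dots> = (\<Sum>A\<in>H. ?w A) - real (card H) / (2 * real D)"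
    by (simp add: sum_subtractf)
  finally have "real (card H) \<le> 2 * real D"
    using D by (simp add: divide_le_eq)
  then show ?thesis
    unfolding D_def by linarith
qed

section \<open>The self-complementary part and the asymptotic upper bounds\<close>

lemma union_intersecting_commute:
  "union_intersecting s t F \<longleftrightarrow> union_intersecting t s F"
proof -
  have "union_intersecting t s F" if "union_intersecting s t F" for s t
    unfolding union_intersecting_iff
  proof (intro allI impI)
    fix X Y
    assume *: "X \<subseteq> F \<and> Y \<subseteq> F \<and> finite X \<and> finite Y \<and> card X = t \<and> card Y = s \<and> X \<inter> Y = {}"
    have "\<exists>A\<in>Y. \<exists>B\<in>X. A \<inter> B \<noteq> {}"
      by (rule union_intersectingD[OF that]) (use * in auto)
    then show "\<Union>X \<inter> \<Union>Y \<noteq> {}"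
      by blast
  qed
  then show ?thesis
    by blast
qed

text \<open>Without \<open>{}\<close>, the two groups formed in \<open>proper_core_few\<close> are
  automatically different, as a common member would be disjoint from itself. Dropping
  \<open>S\<close> as well keeps the family closed under complement; the price is the summand 2 in
  \<open>card_le_proper_core\<close>.\<close>

definition proper_core :: "'a set \<Rightarrow> 'a set set \<Rightarrow> 'a set set" where
  "proper_core S F = compl_core S F - {{}, S}"

lemma proper_core_subset: "proper_core S F \<subseteq> F"
  by (auto simp: proper_core_def compl_core_def)

lemma proper_core_compl:
  assumes "F \<subseteq> Pow S" "A \<in> proper_core S F"
  shows "S - A \<in> proper_core S F"
proof -
  have "A \<in> compl_core S F" "A \<noteq> {}" "A \<noteq> S"
    using assms(2) by (auto simp: proper_core_def)
  moreover from this have "A \<subseteq> S"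
    using assms(1) by (auto simp: compl_core_def)
  ultimately show ?thesis
    using compl_core_compl[OF assms(1)] by (auto simp: proper_core_def)
qed

lemma card_le_proper_core:
  assumes "finite S" "F \<subseteq> Pow S"
  shows "2 * card F \<le> 2 ^ card S + card (proper_core S F) + 2"
proof -
  have "finite (compl_core S F)"
    using assms compl_core_subset by (meson finite_Pow_iff finite_subset)
  then have "card (compl_core S F) \<le> card (proper_core S F \<union> {{}, S})"
    by (intro card_mono) (auto simp: proper_core_def)
  also have "\<dots> \<le> card (proper_core S F) + card {{}, S}"
    by (rule card_Un_le)
  also have "card {{}, S} \<le> 2"
    by (simp add: card_insert_if)
  finally show ?thesis
    using card_le_compl_core[OF assms] by linarith
qed

text \<open>If \<open>{}\<close> is not in \<open>F\<close>, then neither \<open>{}\<close> nor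
  \<open>S\<close> belongs to the core, so nothing is lost.\<close>

lemma card_le_proper_core':
  assumes "finite S" "F \<subseteq> Pow S" "{} \<notin> F"
  shows "2 * card F \<le> 2 ^ card S + card (proper_core S F)"
proof -
  have "proper_core S F = compl_core S F"
    using assms(3) by (auto simp: proper_core_def compl_core_def)
  then show ?thesis
    using card_le_compl_core[OF assms(1,2)] by simp
qed

text \<open>If \<open>C\<close> has \<open>s - 1\<close> members of the core below it and \<open>t - 1\<close> above it, then \<open>C\<close> and the former
  are disjoint from the complements of \<open>C\<close> and of the latter.\<close>

lemma proper_core_few:
  assumes fin: "finite S" and F: "F \<subseteq> Pow S" and ui: "union_intersecting s t F" and C: "C \<in> proper_core S F"
  shows "card {A \<in> proper_core S F. A \<subset> C} + 1 < s \<or> card {B \<in> proper_core S F. C \<subset> B} + 1 < t"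
proof (rule ccontr)
  let ?G = "proper_core S F"
  let ?L = "{A \<in> ?G. A \<subset> C}" and ?U = "{B \<in> ?G. C \<subset> B}"
  assume *: "\<not> ?thesis"
  define X where "X = insert C ?L"
  define Y where "Y = insert (S - C) ((-) S ` ?U)"
  have G: "?G \<subseteq> Pow S"
    using F proper_core_subset by blast
  then have finG: "finite ?G"
    using fin by (meson finite_Pow_iff finite_subset)
  have ne: "A \<noteq> {}" if "A \<in> ?G" for A
    using that by (auto simp: proper_core_def)
  have XY: "X \<subseteq> ?G" "Y \<subseteq> ?G"
    using C proper_core_compl[OF F] by (auto simp: X_def Y_def)
  then have "X \<subseteq> F" "Y \<subseteq> F" "finite X" "finite Y"
    using finG proper_core_subset[of S F] by (meson subset_trans finite_subset)+
  moreover have "s \<le> card X"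
    using * finG by (simp add: X_def)
  moreover have "t \<le> card Y"
  proof -
    have inj: "inj_on ((-) S) ?G"
      using G by (intro inj_onI) blast
    have "Y = (-) S ` insert C ?U"
      by (simp add: Y_def)
    moreover have "insert C ?U \<subseteq> ?G"
      using C by auto
    ultimately have "card Y = card (insert C ?U)"
      using inj by (metis card_image inj_on_subset)
    then show ?thesis
      using * finG by simp
  qed
  moreover have sub: "A \<subseteq> C" "B \<inter> C = {}" if "A \<in> X" "B \<in> Y" for A B
    using that by (auto simp: X_def Y_def)
  then have disj: "A \<inter> B = {}" if "A \<in> X" "B \<in> Y" for A B
    using that by blast
  moreover have "X \<inter> Y = {}"
  proof (rule ccontr)
    assume "X \<inter> Y \<noteq> {}"
    then obtain A where "A \<in> X" "A \<in> Y"
      by auto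
    then show False
      using disj[of A A] ne[of A] XY(1) by auto
  qed
  ultimately have "\<exists>A\<in>X. \<exists>B\<in>Y. A \<inter> B \<noteq> {}"
    by (intro union_intersectingD[OF ui])
  then show False
    using disj by auto
qed

section \<open>Negligible small sets and explicit second-order errors\<close>

lemma card_subsets_by_size:
  assumes "finite S" "finite I"
  shows "card {A. A \<subseteq> S \<and> card A \<in> I} = (\<Sum>i\<in>I. card S choose i)"
proof -
  have "{A. A \<subseteq> S \<and> card A \<in> I} = (\<Union>i\<in>I. {A. A \<subseteq> S \<and> card A = i})"
    by auto
  also have "card \<dots> = (\<Sum>i\<in>I. card {A. A \<subseteq> S \<and> card A = i})"
    using assms by (intro card_UN_disjoint) auto
  also have "\<dots> = (\<Sum>i\<in>I. card S choose i)"
    using assms by (simp add: n_subsets)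
  finally show ?thesis .
qed

lemma card_small_subsets_le:
  assumes "finite S" "card S = n" "n \<ge> 1"
  shows "card {A. A \<subseteq> S \<and> card A < r} \<le> r * n ^ r"
proof -
  have "card {A. A \<subseteq> S \<and> card A \<in> {..<r}} = (\<Sum>i<r. n choose i)"
    using assms by (subst card_subsets_by_size) auto
  also have "\<dots> \<le> (\<Sum>i<r. n ^ r)"
  proof (rule sum_mono)
    fix i assume "i \<in> {..<r}"
    then have "n choose i \<le> n ^ i" "n ^ i \<le> n ^ r"
      using assms(3) binomial_le_pow[of i n] by (auto intro: power_increasing) (cases "i \<le> n"; simp add: binomial_eq_0)
    then show "n choose i \<le> n ^ r"
      by linarith
  qed
  finally show ?thesis
    by simp
qed

lemma two_power_le_central_binomial: "2 ^ n \<le> (n + 1) * (n choose (n div 2))"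
proof -
  have "2 ^ n = (\<Sum>k\<le>n. n choose k)"
    by (rule choose_row_sum[symmetric])
  also have "\<dots> \<le> (\<Sum>k\<le>n. n choose (n div 2))"
    by (intro sum_mono binomial_maximum)
  finally show ?thesis
    by simp
qed

text \<open>A polynomial is compared with a binomial coefficient of size at least
  \<open>2 ^ n / (n + 1)\<close>. The summand 2 pays for the two sets left out of the proper
  core.\<close>

lemma eventually_small_subsets_negligible:
  fixes r :: nat
  shows "\<forall>\<^sub>F n in at_top. real (r * n ^ r) + 2 \<le> real (n choose (n div 2)) * (1 / real n ^ 2)"
proof -
  have "(\<lambda>n. (real r * real n ^ r + 2) * (real n + 1) * real n ^ 2 / 2 ^ n) \<longlonglongrightarrow> 0"
    by real_asymp
  then have "\<forall>\<^sub>F n in at_top. (real r * real n ^ r + 2) * (real n + 1) * real n ^ 2 / 2 ^ n < 1"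
    by (rule order_tendstoD) simp
  with eventually_gt_at_top[of 0] show ?thesis
  proof eventually_elim
    case (elim n)
    have "(real r * real n ^ r + 2) * real n ^ 2 * (real n + 1) < 2 ^ n"
      using elim(2) by (simp add: divide_less_eq mult_ac)
    also have "2 ^ n \<le> real ((n + 1) * (n choose (n div 2)))"
      using two_power_le_central_binomial[of n] by (metis of_nat_le_iff of_nat_numeral of_nat_power)
    also have "\<dots> = real (n choose (n div 2)) * (real n + 1)"
      by (simp add: algebra_simps)
    finally have "(real r * real n ^ r + 2) * real n ^ 2 < real (n choose (n div 2))"
      by (rule mult_right_less_imp_less) simp
    then show ?case
      using elim(1) by (simp add: le_divide_eq)
  qed
qed

text \<open>\<open>1 / u\<close> is the factor lost in \<open>card_few_subsets_le\<close>. As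
  \<open>n div 2 \<ge> (n - 1) / 2\<close>, it is at most
  \<open>1 + 2 * \<rho> / (n - (1 + 2 * \<rho>))\<close>, which is then expanded in powers of
  \<open>1 / n\<close>.\<close>

lemma inverse_one_minus_le:
  fixes \<rho> n :: nat
  assumes "n \<ge> 4 * \<rho> + 4"
  defines "u \<equiv> 1 - real \<rho> / real (n div 2)"
  shows "u > 0" "1 / u \<le> 1 + 2 * real \<rho> / real n + 4 * real \<rho> * (1 + 2 * real \<rho>) / real n ^ 2"
proof -
  define x where "x = real n"
  define r where "r = real \<rho>"
  have x: "x \<ge> 4 * r + 4" "r \<ge> 0"
    using assms(1) unfolding x_def r_def by linarith+
  have k: "real (n div 2) \<ge> (x - 1) / 2" "real (n div 2) > 0"
    using assms(1) unfolding x_def by auto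
  have "r / real (n div 2) \<le> r / ((x - 1) / 2)"
    using k x by (intro divide_left_mono) auto
  also have "\<dots> = 2 * r / (x - 1)"
    by simp
  finally have u: "u \<ge> (x - 1 - 2 * r) / (x - 1)"
    using x by (simp add: u_def r_def[symmetric] diff_divide_distrib)
  moreover have pos: "(x - 1 - 2 * r) / (x - 1) > 0"
    using x by simp
  ultimately show "u > 0"
    by linarith
  have "1 / u \<le> 1 / ((x - 1 - 2 * r) / (x - 1))"
    by (rule divide_left_mono[OF u]) (simp, rule mult_pos_pos[OF \<open>u > 0\<close> pos])
  also have "\<dots> = 1 + 2 * r * (1 / (x - (1 + 2 * r)))"
    using x by (simp add: field_simps)
  also have "\<dots> \<le> 1 + 2 * r * (1 / x + 2 * (1 + 2 * r) / x ^ 2)"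
  proof (intro add_left_mono mult_left_mono)
    define a where "a = 1 + 2 * r"
    \<comment> \<open>The difference is \<open>a * (x - 2 * a)\<close>, and
      \<open>n \<ge> 4 * \<rho> + 4\<close> ensures \<open>x \<ge> 2 * a\<close>.\<close>
    have "x ^ 2 \<le> (x + 2 * a) * (x - a)"
    proof -
      have "0 \<le> a * (x - 2 * a)"
        using x by (intro mult_nonneg_nonneg) (auto simp: a_def)
      then show ?thesis
        by (simp add: algebra_simps power2_eq_square)
    qed
    moreover have "x - a > 0" "x > 0"
      using x by (auto simp: a_def)
    ultimately have "1 / (x - a) \<le> (x + 2 * a) / x ^ 2"
      by (simp add: divide_le_eq le_divide_eq)
    also have "\<dots> = 1 / x + 2 * a / x ^ 2"
      using \<open>x > 0\<close> by (simp add: add_divide_distrib power2_eq_square)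
    finally show "1 / (x - (1 + 2 * r)) \<le> 1 / x + 2 * (1 + 2 * r) / x ^ 2"
      by (simp add: a_def)
  qed (use x in auto)
  also have "\<dots> = 1 + 2 * r / x + 4 * r * (1 + 2 * r) / x ^ 2"
    by (simp add: algebra_simps)
  finally show "1 / u \<le> 1 + 2 * real \<rho> / real n + 4 * real \<rho> * (1 + 2 * real \<rho>) / real n ^ 2"
    by (simp add: x_def r_def)
qed

text \<open>The sets with fewer than \<open>3 * \<rho>\<close> elements are dropped at polynomial
  cost, which accounts for the \<open>+ 1\<close> in \<open>?K\<close>. The quantifiers over
  \<open>S\<close> and \<open>H\<close> stand inside, so that one \<open>K\<close> and one threshold
  serve all families.\<close>

lemma eventually_card_few_subsets_le:
  fixes \<rho> :: nat
  shows "\<exists>K. \<forall>\<^sub>F n in at_top. \<forall>(S :: 'a set) H. finite S \<and> card S = n \<and> H \<subseteq> Pow S \<and> (\<forall>B\<in>H. card {A \<in> H. A \<subset> B} \<le> \<rho>)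
     \<longrightarrow> real (card H) + 2 \<le> real (n choose (n div 2)) * (1 + 2 * real \<rho> / real n + K / real n ^ 2)"
proof
  let ?K = "4 * real \<rho> * (1 + 2 * real \<rho>) + 1"
  show "\<forall>\<^sub>F n in at_top. \<forall>(S :: 'a set) H. finite S \<and> card S = n \<and> H \<subseteq> Pow S \<and> (\<forall>B\<in>H. card {A \<in> H. A \<subset> B} \<le> \<rho>)
     \<longrightarrow> real (card H) + 2 \<le> real (n choose (n div 2)) * (1 + 2 * real \<rho> / real n + ?K / real n ^ 2)"
    using eventually_small_subsets_negligible[of "3 * \<rho>"] eventually_ge_at_top[of "4 * \<rho> + 4"]
  proof eventually_elim
    case (elim n)
    define M where "M = real (n choose (n div 2))"
    define u where "u = 1 - real \<rho> / real (n div 2)"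
    show ?case
    proof (intro allI impI, elim conjE)
      fix S :: "'a set" and H
      assume S: "finite S" "card S = n" and H: "H \<subseteq> Pow S" and few: "\<forall>B\<in>H. card {A \<in> H. A \<subset> B} \<le> \<rho>"
      define H' where "H' = {B \<in> H. 3 * \<rho> \<le> card B}"
      have finH: "finite H"
        using S H by (meson finite_Pow_iff finite_subset)
      have "H \<subseteq> H' \<union> {A. A \<subseteq> S \<and> card A < 3 * \<rho>}"
        using H by (auto simp: H'_def)
      moreover have "finite (H' \<union> {A. A \<subseteq> S \<and> card A < 3 * \<rho>})"
        using finH S by (auto simp: H'_def)
      ultimately have "card H \<le> card (H' \<union> {A. A \<subseteq> S \<and> card A < 3 * \<rho>})"
        by (rule card_mono[rotated])
      also have "\<dots> \<le> card H' + card {A. A \<subseteq> S \<and> card A < 3 * \<rho>}"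
        by (rule card_Un_le)
      also have "card {A. A \<subseteq> S \<and> card A < 3 * \<rho>} \<le> 3 * \<rho> * n ^ (3 * \<rho>)"
        using S elim(2) by (intro card_small_subsets_le) auto
      finally have "real (card H) \<le> real (card H' + 3 * \<rho> * n ^ (3 * \<rho>))"
        unfolding of_nat_le_iff by simp
      moreover have "real (card H') * u \<le> M"
        unfolding M_def u_def
      proof (rule card_few_subsets_le[OF S(1) _ S(2)])
        fix B assume B: "B \<in> H'"
        have "card {A \<in> H'. A \<subset> B} \<le> card {A \<in> H. A \<subset> B}"
          using finH by (intro card_mono) (auto simp: H'_def)
        also have "\<dots> \<le> \<rho>"
          using few B by (auto simp: H'_def)
        finally show "card {A \<in> H'. A \<subset> B} \<le> \<rho>" .
      qed (use H elim(2) in \<open>auto simp: H'_def\<close>)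
      then have "real (card H') \<le> M * (1 / u)"
        using inverse_one_minus_le(1)[OF elim(2)] by (simp add: u_def[symmetric] le_divide_eq)
      moreover have "M * (1 / u) \<le> M * (1 + 2 * real \<rho> / real n + 4 * real \<rho> * (1 + 2 * real \<rho>) / real n ^ 2)"
        unfolding u_def M_def by (intro mult_left_mono inverse_one_minus_le(2)[OF elim(2)]) simp
      moreover have "real (3 * \<rho> * n ^ (3 * \<rho>)) + 2 \<le> M * (1 / real n ^ 2)"
        using elim(1) by (simp add: M_def)
      ultimately have "real (card H) + 2 \<le> M * (1 + 2 * real \<rho> / real n + 4 * real \<rho> * (1 + 2 * real \<rho>) / real n ^ 2)
          + M * (1 / real n ^ 2)"
        by simp
      also have "\<dots> = M * (1 + 2 * real \<rho> / real n + ?K / real n ^ 2)"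
        by (simp add: distrib_left add_divide_distrib)
      finally show "real (card H) + 2 \<le> real (n choose (n div 2)) * (1 + 2 * real \<rho> / real n + ?K / real n ^ 2)"
        by (simp add: M_def)
    qed
  qed
qed

text \<open>Complementation reverses inclusion within \<open>G\<close>: if few members lie above
  \<open>C\<close>, then few lie below its complement. Thus bounds on the members below suffice for
  both parts.\<close>

lemma proper_core_few_cover:
  assumes "finite S" and F: "F \<subseteq> Pow S" and "union_intersecting s t F"
  defines "G \<equiv> proper_core S F"
  shows "G \<subseteq> {C \<in> G. card {A \<in> G. A \<subset> C} + 1 < s} \<union> (-) S ` {C \<in> G. card {A \<in> G. A \<subset> C} + 1 < t}"
proof
  fix C assume C: "C \<in> G"
  have GS: "G \<subseteq> Pow S"
    using F proper_core_subset unfolding G_def by blast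
  then have finG: "finite G"
    using assms(1) by (meson finite_Pow_iff finite_subset)
  have compl: "S - A \<in> G" if "A \<in> G" for A
    using that proper_core_compl[OF F] unfolding G_def by blast
  show "C \<in> {C \<in> G. card {A \<in> G. A \<subset> C} + 1 < s} \<union> (-) S ` {C \<in> G. card {A \<in> G. A \<subset> C} + 1 < t}"
  proof (cases "card {A \<in> G. A \<subset> C} + 1 < s")
    case False
    then have above: "card {B \<in> G. C \<subset> B} + 1 < t"
      using proper_core_few[OF assms(1-3)] C unfolding G_def by blast
    have "{A \<in> G. A \<subset> S - C} \<subseteq> (-) S ` {B \<in> G. C \<subset> B}"
    proof
      fix A assume A: "A \<in> {A \<in> G. A \<subset> S - C}"
      then have "S - A \<in> {B \<in> G. C \<subset> B}" "A = S - (S - A)"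
        using compl GS C by auto
      then show "A \<in> (-) S ` {B \<in> G. C \<subset> B}"
        by blast
    qed
    then have "card {A \<in> G. A \<subset> S - C} \<le> card {B \<in> G. C \<subset> B}"
      using finG by (intro surj_card_le) auto
    then have "S - C \<in> {C \<in> G. card {A \<in> G. A \<subset> C} + 1 < t}"
      using above compl[OF C] by simp
    moreover have "C = S - (S - C)"
      using GS C by auto
    ultimately show ?thesis
      by blast
  qed (use C in auto)
qed

lemma eventually_union_intersecting_one_le:
  assumes "t \<ge> 2"
  shows "\<exists>K. \<forall>\<^sub>F n in at_top. real (max_union_intersecting n 1 t)
     \<le> 2 ^ (n - 1) + real (n choose (n div 2)) * (1 / 2 + (real t - 2) / real n + K / real n ^ 2)"
proof -
  obtain K where K: "\<forall>\<^sub>F n in at_top. \<forall>(S :: nat set) H. finite S \<and> card S = n \<and> H \<subseteq> Pow S \<and>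
     (\<forall>B\<in>H. card {A \<in> H. A \<subset> B} \<le> t - 2)
     \<longrightarrow> real (card H) + 2 \<le> real (n choose (n div 2)) * (1 + 2 * real (t - 2) / real n + K / real n ^ 2)"
    using eventually_card_few_subsets_le by blast
  have "\<forall>\<^sub>F n in at_top. real (max_union_intersecting n 1 t)
     \<le> 2 ^ (n - 1) + real (n choose (n div 2)) * (1 / 2 + (real t - 2) / real n + (K / 2) / real n ^ 2)"
    using K eventually_gt_at_top[of 0]
  proof eventually_elim
    case (elim n)
    let ?rhs = "2 ^ (n - 1) + real (n choose (n div 2)) * (1 / 2 + (real t - 2) / real n + (K / 2) / real n ^ 2)"
    have "real (card F) \<le> ?rhs" if F: "F \<subseteq> Pow {1..n}" "union_intersecting 1 t F" for F
    proof -
      let ?G = "proper_core {1..n} F"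
      \<comment> \<open>With the groups exchanged, the second alternative of
        \<open>proper_core_few\<close> would be a successor less than 1, so the first always
        holds.\<close>
      have "card {A \<in> ?G. A \<subset> B} \<le> t - 2" if "B \<in> ?G" for B
        using proper_core_few[OF _ F(1) _ that, of t 1] F(2) by (auto simp: union_intersecting_commute)
      moreover have "?G \<subseteq> Pow {1..n}"
        using F(1) proper_core_subset by blast
      ultimately have "real (card ?G) + 2 \<le> real (n choose (n div 2)) * (1 + 2 * real (t - 2) / real n + K / real n ^ 2)"
        using elim(1)[rule_format, of "{1..n}" ?G] by simp
      also have "\<dots> = 2 * (real (n choose (n div 2)) * (1 / 2 + (real t - 2) / real n + (K / 2) / real n ^ 2))"
        using assms by (simp add: of_nat_diff algebra_simps diff_divide_distrib add_divide_distrib)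
      moreover have "real (2 * card F) \<le> real (2 ^ card {1..n} + card ?G + 2)"
        using card_le_proper_core[OF _ F(1)] unfolding of_nat_le_iff by simp
      moreover have "(2 :: real) ^ n = 2 * 2 ^ (n - 1)"
        using elim(2) by (simp add: power_eq_if)
      ultimately show ?thesis
        by simp
    qed
    then show ?case
      using max_union_intersecting_attained[of 1 n t] by (metis zero_less_one)
  qed
  then show ?thesis
    by blast
qed

text \<open>The two parts of the core contribute the linear terms \<open>2 * (s - 2) / n\<close> and
  \<open>2 * (t - 2) / n\<close>; halving their sum gives \<open>s + t - 4\<close>.\<close>

lemma eventually_union_intersecting_le:
  assumes "s \<ge> 2" "t \<ge> 2"
  shows "\<exists>K. \<forall>\<^sub>F n in at_top. real (max_union_intersecting n s t)
     \<le> 2 ^ (n - 1) + real (n choose (n div 2)) * (1 + (real s + real t - 4) / real n + K / real n ^ 2)"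
proof -
  obtain K where K: "\<forall>\<^sub>F n in at_top. \<forall>(S :: nat set) H. finite S \<and> card S = n \<and> H \<subseteq> Pow S \<and>
     (\<forall>B\<in>H. card {A \<in> H. A \<subset> B} \<le> s - 2)
     \<longrightarrow> real (card H) + 2 \<le> real (n choose (n div 2)) * (1 + 2 * real (s - 2) / real n + K / real n ^ 2)"
    using eventually_card_few_subsets_le by blast
  obtain L where L: "\<forall>\<^sub>F n in at_top. \<forall>(S :: nat set) H. finite S \<and> card S = n \<and> H \<subseteq> Pow S \<and>
     (\<forall>B\<in>H. card {A \<in> H. A \<subset> B} \<le> t - 2)
     \<longrightarrow> real (card H) + 2 \<le> real (n choose (n div 2)) * (1 + 2 * real (t - 2) / real n + L / real n ^ 2)"
    using eventually_card_few_subsets_le by blast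
  have "\<forall>\<^sub>F n in at_top. real (max_union_intersecting n s t)
     \<le> 2 ^ (n - 1) + real (n choose (n div 2)) * (1 + (real s + real t - 4) / real n + ((K + L) / 2) / real n ^ 2)"
    using K L eventually_gt_at_top[of 0]
  proof eventually_elim
    case (elim n)
    define M where "M = real (n choose (n div 2))"
    let ?rhs = "2 ^ (n - 1) + M * (1 + (real s + real t - 4) / real n + ((K + L) / 2) / real n ^ 2)"
    have *: "real (card F) \<le> ?rhs" if F: "F \<subseteq> Pow {1..n}" "union_intersecting s t F" for F
    proof -
      define G where "G = proper_core {1..n} F"
      define few where "few r = {C \<in> G. card {A \<in> G. A \<subset> C} + 1 < r}" for r
      have G: "G \<subseteq> Pow {1..n}"
        using F(1) proper_core_subset unfolding G_def by blast
      then have finG: "finite G"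
        by (rule finite_subset) simp
      have fewG: "few r \<subseteq> Pow {1..n}" "finite (few r)" for r
        using G finG by (auto simp: few_def)
      have few: "card {A \<in> few r. A \<subset> B} \<le> r - 2" if "B \<in> few r" for r B
      proof -
        have "card {A \<in> few r. A \<subset> B} \<le> card {A \<in> G. A \<subset> B}"
          using finG by (intro card_mono) (auto simp: few_def)
        then show ?thesis
          using that by (auto simp: few_def)
      qed
      have "real (card (few s)) + 2 \<le> M * (1 + 2 * real (s - 2) / real n + K / real n ^ 2)"
        using elim(1)[rule_format, of "{1..n}" "few s"] fewG few unfolding M_def by simp
      moreover have "real (card (few t)) + 2 \<le> M * (1 + 2 * real (t - 2) / real n + L / real n ^ 2)"
        using elim(2)[rule_format, of "{1..n}" "few t"] fewG few unfolding M_def by simp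
      moreover have "M * (1 + 2 * real (s - 2) / real n + K / real n ^ 2) + M * (1 + 2 * real (t - 2) / real n + L / real n ^ 2)
         = 2 * (M * (1 + (real s + real t - 4) / real n + ((K + L) / 2) / real n ^ 2))"
        using assms by (simp add: of_nat_diff algebra_simps diff_divide_distrib add_divide_distrib)
      moreover have "card G \<le> card (few s) + card (few t)"
      proof -
        have "card G \<le> card (few s \<union> (-) {1..n} ` few t)"
          using proper_core_few_cover[OF _ F] fewG unfolding few_def G_def by (intro card_mono) auto
        also have "\<dots> \<le> card (few s) + card ((-) {1..n} ` few t)"
          by (rule card_Un_le)
        also have "card ((-) {1..n} ` few t) \<le> card (few t)"
          using fewG by (intro card_image_le)
        finally show ?thesis
          by simp
      qed
      then have "real (card G) \<le> real (card (few s)) + real (card (few t))"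
        by linarith
      moreover have "real (2 * card F) \<le> real (2 ^ card {1..n} + card G + 2)"
        using card_le_proper_core[OF _ F(1)] unfolding of_nat_le_iff G_def by simp
      moreover have "(2 :: real) ^ n = 2 * 2 ^ (n - 1)"
        using elim(3) by (simp add: power_eq_if)
      ultimately show ?thesis
        by simp
    qed
    have "s > 0"
      using assms by simp
    then show ?case
      using max_union_intersecting_attained[of s n t] * unfolding M_def by metis
  qed
  then show ?thesis
    by blast
qed

text \<open>Take for \<open>h\<close> the positive part of the relative excess of \<open>f\<close>.
  The inequality then holds for every \<open>n\<close>, and the eventual bound serves only to
  control the growth of \<open>h\<close>.\<close>

lemma obtain_error_term:
  fixes f g M c :: "nat \<Rightarrow> real"
  assumes "\<And>n. M n > 0" and ev: "\<forall>\<^sub>F n in at_top. f n \<le> g n + M n * (c n + K / real n ^ 2)"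
  shows "\<exists>h :: nat \<Rightarrow> real. h \<in> O(\<lambda>n. 1 / real n ^ 2) \<and> (\<forall>n. f n \<le> g n + M n * (c n + h n))"
proof (intro exI conjI allI)
  define h where "h n = max 0 ((f n - g n) / M n - c n)" for n
  have "\<forall>\<^sub>F n in at_top. norm (h n) \<le> \<bar>K\<bar> * norm (1 / real n ^ 2)"
    using ev
  proof eventually_elim
    case (elim n)
    then have "(f n - g n) / M n \<le> c n + K / real n ^ 2"
      using assms(1)[of n] by (simp add: divide_le_eq mult.commute)
    moreover have "K / real n ^ 2 \<le> \<bar>K\<bar> / real n ^ 2"
      by (intro divide_right_mono) auto
    moreover have "\<bar>K\<bar> / real n ^ 2 \<ge> 0"
      by simp
    ultimately have "h n \<le> \<bar>K\<bar> / real n ^ 2" "h n \<ge> 0"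
      unfolding h_def by linarith+
    then show ?case
      by simp
  qed
  then show "h \<in> O(\<lambda>n. 1 / real n ^ 2)"
    by (rule bigoI)
  fix n
  have "(f n - g n) / M n \<le> c n + h n"
    by (simp add: h_def)
  then show "f n \<le> g n + M n * (c n + h n)"
    using assms(1)[of n] by (simp add: divide_le_eq mult.commute)
qed

section \<open>Arcs on a circle\<close>

text \<open>The circle has \<open>n\<close> points, unrolled to the integers; \<open>P i e\<close> says that the nonempty proper arc
  \<open>{i..<e}\<close> belongs to a family of arcs that is closed under complement.\<close>

locale arc_system =
  fixes n :: int and P :: "int \<Rightarrow> int \<Rightarrow> bool"
  assumes n_pos: "n > 0"
    and range: "P i e \<Longrightarrow> i < e \<and> e < i + n"
    and shift: "P (i + n) (e + n) \<longleftrightarrow> P i e"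
    and compl: "P i e \<Longrightarrow> P e (i + n)"
begin

definition arcs :: "(int \<times> int) set" where
  "arcs = {(i, e). 0 \<le> i \<and> i < n \<and> P i e}"

lemma finite_ends: "finite {e. P i e}"
  by (rule finite_subset[of _ "{i<..<i + n}"]) (auto dest: range)

lemma arcs_eq_Sigma: "arcs = Sigma {0..<n} (\<lambda>i. {e. P i e})"
  by (auto simp: arcs_def)

lemma card_arcs: "card arcs = (\<Sum>i\<in>{0..<n}. card {e. P i e})"
  unfolding arcs_eq_Sigma using finite_ends by (intro card_SigmaI) auto

lemma finite_arcs: "finite arcs"
  unfolding arcs_eq_Sigma using finite_ends by auto

text \<open>Complementation exchanges the arcs ending before \<open>n\<close> with the others.\<close>

lemma even_card_arcs: "even (card arcs)"
proof -
  let ?X = "{(i, e). (i, e) \<in> arcs \<and> e < n}" and ?Y = "{(i, e). (i, e) \<in> arcs \<and> \<not> e < n}"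
  have "bij_betw (\<lambda>(i, e). (e, i + n)) ?X ?Y"
  proof (rule bij_betw_byWitness[of _ "\<lambda>(i, e). (e - n, i)"])
    have "P (e - n) i" if "P i e" for i e
      using compl[OF that] shift[of "e - n" i] by simp
    then show "(\<lambda>(i, e). (e - n, i)) ` ?Y \<subseteq> ?X"
      unfolding arcs_def using range by force
    show "(\<lambda>(i, e). (e, i + n)) ` ?X \<subseteq> ?Y"
      unfolding arcs_def using range compl by force
  qed auto
  then have eq: "card ?X = card ?Y"
    by (rule bij_betw_same_card)
  have fin: "finite ?X" "finite ?Y"
    by (rule finite_subset[OF _ finite_arcs], auto)+
  have "card arcs = card (?X \<union> ?Y)"
    by (rule arg_cong[of _ _ card]) auto
  also have "\<dots> = card ?X + card ?Y"
    by (rule card_Un_disjoint[OF fin]) auto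
  finally show ?thesis
    unfolding eq by simp
qed

lemma card_arcs_antichain_less:
  assumes "odd n" and anti: "\<And>i e e'. P i e \<Longrightarrow> P i e' \<Longrightarrow> \<not> e < e'"
  shows "int (card arcs) \<le> n - 1"
proof -
  have "card {e. P i e} \<le> 1" for i
  proof -
    have "e = e'" if "P i e" "P i e'" for e e'
      using anti[of i e e'] anti[of i e' e] that by linarith
    then show ?thesis
      using finite_ends[of i] by (subst One_nat_def, subst card_le_Suc0_iff_eq) auto
  qed
  then have "card arcs \<le> (\<Sum>i\<in>{0..<n}. 1)"
    unfolding card_arcs by (intro sum_mono)
  then have "int (card arcs) \<le> n"
    using n_pos by simp
  moreover have "even (int (card arcs))"
    using even_card_arcs by simp
  ultimately show ?thesis
    using assms(1) by (cases "int (card arcs) = n") auto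
qed

text \<open>Three arcs with a common start are nested. In \<open>no3\<close> containment is
  expressed through unrolled end points: the first inclusion is proper, and the conclusion forbids
  the second from being proper.\<close>

lemma ends_le_two:
  assumes no3: "\<And>i i' i'' e e' e''. P i e \<Longrightarrow> P i' e' \<Longrightarrow> P i'' e'' \<Longrightarrow> i' \<le> i \<Longrightarrow> e \<le> e' \<Longrightarrow> (i, e) \<noteq> (i', e')
     \<Longrightarrow> i'' \<le> i' \<Longrightarrow> e' \<le> e'' \<Longrightarrow> (i', e') = (i'', e'')"
  shows "card {e. P i e} \<le> 2"
proof (rule ccontr)
  assume "\<not> ?thesis"
  then obtain T where T: "T \<subseteq> {e. P i e}" "card T = 3" "finite T"
    using obtain_subset_with_card_n[of 3 "{e. P i e}"] by force
  define a where "a = Min T"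
  define c where "c = Max T"
  have "T \<noteq> {}"
    using T by auto
  then have ac: "a \<in> T" "c \<in> T"
    using T by (auto simp: a_def c_def)
  have "card {a, c} \<le> 2"
    by (simp add: card_insert_if)
  then have "\<not> T \<subseteq> {a, c}"
    using T card_mono[of "{a, c}" T] by auto
  then obtain b where b: "b \<in> T" "b \<noteq> a" "b \<noteq> c"
    by auto
  then have "a \<le> b" "b \<le> c"
    using T by (auto simp: a_def c_def)
  then show False
    using no3[of i a i b i c] ac b T(1) by auto
qed

text \<open>The full count forces exactly two ends at every start, with lengths independent of the
  start. If one length were half of \<open>n\<close>, the complement of an arc of the other length
  would lie on the opposite side of the half and have a third length.\<close>

lemma no_half_arc:
  assumes no3: "\<And>i i' i'' e e' e''. P i e \<Longrightarrow> P i' e' \<Longrightarrow> P i'' e'' \<Longrightarrow> i' \<le> i \<Longrightarrow> e \<le> e' \<Longrightarrow> (i, e) \<noteq> (i', e')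
     \<Longrightarrow> i'' \<le> i' \<Longrightarrow> e' \<le> e'' \<Longrightarrow> (i', e') = (i'', e'')"
    and full: "int (card arcs) = 2 * n"
  shows "\<not> P i (i + m) \<or> 2 * m \<noteq> n"
proof (rule ccontr)
  assume "\<not> ?thesis"
  then have m: "P i (i + m)" "n = 2 * m"
    by auto
  have le2: "card {e. P i e} \<le> 2" for i
    by (rule ends_le_two[OF no3])
  have two0: "card {e. P i e} = 2" if "i \<in> {0..<n}" for i
  proof (rule ccontr)
    assume "card {e. P i e} \<noteq> 2"
    then have "(\<Sum>i\<in>{0..<n}. card {e. P i e}) < (\<Sum>i\<in>{0..<n}. 2)"
      using le2 that by (intro sum_strict_mono_ex1) (auto intro!: bexI[of _ i] simp: le_neq_implies_less)
    also have "\<dots> = 2 * nat n"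
      by simp
    finally show False
      using full n_pos unfolding card_arcs by linarith
  qed
  have shift_mult: "P (i + int k * n) (e + int k * n) \<longleftrightarrow> P i e" for i e k
  proof (induction k)
    case (Suc k)
    then show ?case
      using shift[of "i + int k * n" "e + int k * n"] by (simp add: algebra_simps)
  qed simp
  have shift_int: "P (i + k * n) (e + k * n) \<longleftrightarrow> P i e" for i e k
  proof (cases "k \<ge> 0")
    case True
    then show ?thesis
      using shift_mult[of i "nat k" e] by simp
  next
    case False
    then show ?thesis
      using shift_mult[of "i + k * n" "nat (- k)" "e + k * n"] by simp
  qed
  \<comment> \<open>Stated for all integers, because \<open>\<alpha>\<close> and
    \<open>\<beta>\<close> are later evaluated at ends of arcs, which may lie outside
    \<open>{0..<n}\<close>.\<close>
  have two: "card {e. P i e} = 2" for i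
  proof -
    let ?c = "(i div n) * n"
    have "i = i mod n + ?c"
      by simp
    have "bij_betw (\<lambda>e. e + ?c) {e. P (i mod n) e} {e. P i e}"
    proof (rule bij_betw_byWitness[of _ "\<lambda>e. e - ?c"])
      show "(\<lambda>e. e + ?c) ` {e. P (i mod n) e} \<subseteq> {e. P i e}"
        using shift_int[of "i mod n" "i div n"] by auto
      show "(\<lambda>e. e - ?c) ` {e. P i e} \<subseteq> {e. P (i mod n) e}"
      proof clarify
        fix e assume "P i e"
        then show "P (i mod n) (e - ?c)"
          using shift_int[of "i mod n" "i div n" "e - ?c"] by simp
      qed
    qed auto
    then show ?thesis
      using two0[of "i mod n"] n_pos by (metis atLeastLessThan_iff bij_betw_same_card pos_mod_bound pos_mod_sign)
  qed
  define \<alpha> where "\<alpha> i = Min {e. P i e}" for i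
  define \<beta> where "\<beta> i = Max {e. P i e}" for i
  have ends: "P i (\<alpha> i)" "P i (\<beta> i)" "\<alpha> i < \<beta> i" "\<And>e. P i e \<Longrightarrow> e = \<alpha> i \<or> e = \<beta> i" for i
  proof -
    obtain x y where xy: "{e. P i e} = {x, y}" "x < y"
      using two[of i] by (metis card_2_iff insert_commute linorder_neqE_linordered_idom)
    then have "\<alpha> i = x" "\<beta> i = y"
      by (auto simp: \<alpha>_def \<beta>_def)
    then show "P i (\<alpha> i)" "P i (\<beta> i)" "\<alpha> i < \<beta> i" "\<And>e. P i e \<Longrightarrow> e = \<alpha> i \<or> e = \<beta> i"
      using xy by auto
  qed
  \<comment> \<open>Otherwise the first arc from \<open>i + 1\<close> lies properly inside the first
    arc from \<open>i\<close>, which lies properly inside the second arc from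
    \<open>i\<close>.\<close>
  have \<alpha>_step: "\<alpha> (i + 1) \<ge> \<alpha> i + 1" for i
    using no3[of "i + 1" "\<alpha> (i + 1)" i "\<alpha> i" i "\<beta> i"] ends[of i] ends[of "i + 1"] by force
  \<comment> \<open>Otherwise both arcs from \<open>i + 1\<close> lie properly inside the longer arc
    from \<open>i\<close>.\<close>
  have \<beta>_step: "\<beta> (i + 1) \<ge> \<beta> i + 1" for i
    using no3[of "i + 1" "\<alpha> (i + 1)" "i + 1" "\<beta> (i + 1)" i "\<beta> i"] ends[of i] ends[of "i + 1"] by force
  have ends_shift: "\<alpha> (i + n) = \<alpha> i + n" "\<beta> (i + n) = \<beta> i + n" for i
    using ends[of i] ends[of "i + n"] shift[of i "\<alpha> i"] shift[of i "\<beta> i"] by (smt (verit))+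
  text \<open>An increasing integer sequence that grows by \<open>n\<close> in \<open>n\<close> steps grows by one in each step.\<close>
  have const: "\<gamma> j - j = \<gamma> i - i"
    if step: "\<And>i. \<gamma> (i + 1) \<ge> \<gamma> i + 1" and per: "\<And>i. \<gamma> (i + n) = \<gamma> i + n" for \<gamma> :: "int \<Rightarrow> int" and i j
  proof -
    have grow: "\<gamma> (i + int k) \<ge> \<gamma> i + int k" for i k
    proof (induction k)
      case (Suc k)
      then show ?case
        using step[of "i + int k"] by (simp add: algebra_simps)
    qed simp
    have le: "\<gamma> i - i \<le> \<gamma> j - j" if "i \<le> j" for i j
      using grow[of i "nat (j - i)"] that by simp
    have perk: "\<gamma> (i + int k * n) = \<gamma> i + int k * n" for i k
    proof (induction k)
      case (Suc k)
      then show ?case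
        using per[of "i + int k * n"] by (simp add: algebra_simps)
    qed simp
    have ge: "\<gamma> j - j \<le> \<gamma> i - i" for i j
    proof -
      have "int (nat \<bar>j - i\<bar>) * 1 \<le> int (nat \<bar>j - i\<bar>) * n"
        using n_pos by (intro mult_left_mono) auto
      then have "j \<le> i + int (nat \<bar>j - i\<bar>) * n"
        by linarith
      from le[OF this] show ?thesis
        using perk[of i "nat \<bar>j - i\<bar>"] by linarith
    qed
    show ?thesis
      using ge[of i j] ge[of j i] by linarith
  qed
  have \<alpha>_const: "\<alpha> j - j = \<alpha> i - i" and \<beta>_const: "\<beta> j - j = \<beta> i - i" for i j
    using const[of \<alpha>] const[of \<beta>] \<alpha>_step \<beta>_step ends_shift by blast+
  show False
    using ends(4)[OF m(1)]
  proof
    assume "i + m = \<alpha> i"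
    moreover have "P (\<beta> i) (i + n)"
      using compl ends(2) by blast
    ultimately show False
      using ends(3)[of i] ends(3)[of "\<beta> i"] ends(4)[of "\<beta> i" "i + n"] \<alpha>_const[of "\<beta> i" i] m(2) by linarith
  next
    assume "i + m = \<beta> i"
    moreover have "P (\<alpha> i) (i + n)"
      using compl ends(1) by blast
    ultimately show False
      using ends(3)[of i] ends(3)[of "\<alpha> i"] ends(4)[of "\<alpha> i" "i + n"] \<beta>_const[of "\<alpha> i" i] m(2) by linarith
  qed
qed

end

section \<open>Arcs of a circularly ordered list\<close>

text \<open>Indexing is periodic on all integers, so an arc running past the end of the list is
  still the image of an integer interval.\<close>

definition circ :: "'a list \<Rightarrow> int \<Rightarrow> 'a" where
  "circ xs k = xs ! nat (k mod int (length xs))"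

definition circ_arc :: "'a list \<Rightarrow> int \<Rightarrow> int \<Rightarrow> 'a set" where
  "circ_arc xs i e = circ xs ` {i..<e}"

lemma circ_arc_shift: "circ_arc xs (i + int (length xs)) (e + int (length xs)) = circ_arc xs i e"
proof -
  have "{i + int (length xs)..<e + int (length xs)} = (\<lambda>k. k + int (length xs)) ` {i..<e}"
    by simp
  then show ?thesis
    unfolding circ_arc_def image_image by (simp only: image_image) (simp add: circ_def)
qed

lemma inj_on_circ:
  assumes "distinct xs"
  shows "inj_on (circ xs) {i..<i + int (length xs)}"
proof (rule inj_onI)
  fix k l
  let ?n = "int (length xs)"
  assume kl: "k \<in> {i..<i + ?n}" "l \<in> {i..<i + ?n}" "circ xs k = circ xs l"
  then have n: "?n > 0"
    by auto
  then have "nat (k mod ?n) < length xs" "nat (l mod ?n) < length xs"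
    by (auto simp: nat_less_iff)
  then have "nat (k mod ?n) = nat (l mod ?n)"
    using kl(3) assms by (simp add: circ_def nth_eq_iff_index_eq)
  then have "k mod ?n = l mod ?n"
    using n by (simp add: nat_eq_iff)
  then have "?n dvd k - l"
    by (simp add: mod_eq_dvd_iff)
  then show "k = l"
    using kl(1,2) zdvd_imp_le[of ?n "k - l"] zdvd_imp_le[of ?n "l - k"] by (force simp: dvd_diff_commute)
qed

lemma card_circ_arc:
  assumes "distinct xs" "i \<le> e" "e \<le> i + int (length xs)"
  shows "card (circ_arc xs i e) = nat (e - i)"
proof -
  have "inj_on (circ xs) {i..<e}"
    by (rule inj_on_subset[OF inj_on_circ[OF assms(1), of i]]) (use assms in auto)
  then show ?thesis
    by (simp add: circ_arc_def card_image)
qed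

lemma circ_arc_subset_set:
  assumes "xs \<noteq> []"
  shows "circ_arc xs i e \<subseteq> set xs"
proof -
  have "nat (k mod int (length xs)) < length xs" for k
    using assms by (simp add: nat_less_iff)
  then show ?thesis
    by (auto simp: circ_arc_def circ_def)
qed

lemma circ_arc_full:
  assumes "distinct xs" "xs \<noteq> []"
  shows "circ_arc xs i (i + int (length xs)) = set xs"
proof (rule card_subset_eq)
  show "card (circ_arc xs i (i + int (length xs))) = card (set xs)"
    using assms by (simp add: card_circ_arc distinct_card)
qed (use circ_arc_subset_set[OF assms(2)] in auto)

lemma circ_arc_compl:
  assumes "distinct xs" "xs \<noteq> []" "i \<le> e" "e \<le> i + int (length xs)"
  shows "set xs - circ_arc xs i e = circ_arc xs e (i + int (length xs))"
proof -
  let ?n = "int (length xs)"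
  have "set xs - circ_arc xs i e = circ xs ` {i..<i + ?n} - circ xs ` {i..<e}"
    using circ_arc_full[OF assms(1,2), of i] by (simp add: circ_arc_def)
  also have "\<dots> = circ xs ` ({i..<i + ?n} - {i..<e})"
    by (rule inj_on_image_set_diff[OF inj_on_circ[OF assms(1)], symmetric]) (use assms in auto)
  also have "{i..<i + ?n} - {i..<e} = {e..<i + ?n}"
    using assms by auto
  finally show ?thesis
    by (simp add: circ_arc_def)
qed

text \<open>This is the bridge by which the count of permutations with a given prefix also counts
  arcs.\<close>

lemma circ_arc_eq_prefix:
  assumes "i < length xs" "j \<le> length xs"
  shows "set (take j (rotate i xs)) = circ_arc xs (int i) (int i + int j)"
proof -
  have "set (take j (rotate i xs)) = (\<lambda>k. rotate i xs ! k) ` {..<j}"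
    using assms nth_image[of j "rotate i xs"] by (simp add: atLeast0LessThan)
  also have "\<dots> = (\<lambda>k. circ xs (int i + int k)) ` {..<j}"
    using assms by (intro image_cong) (auto simp: nth_rotate circ_def nat_mod_distrib simp flip: of_nat_add)
  also have "\<dots> = circ xs ` {int i..<int i + int j}"
  proof -
    have "{int i..<int i + int j} = (\<lambda>k. int i + int k) ` {..<j}"
    proof (intro equalityI subsetI)
      fix x assume "x \<in> {int i..<int i + int j}"
      then show "x \<in> (\<lambda>k. int i + int k) ` {..<j}"
        by (intro image_eqI[of _ _ "nat (x - int i)"]) auto
    qed auto
    then show ?thesis
      by (simp add: image_image)
  qed
  finally show ?thesis
    by (simp add: circ_arc_def)
qed

definition member_arcs :: "'a list \<Rightarrow> 'a set set \<Rightarrow> (int \<times> int) set" where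
  "member_arcs xs H = {(i, e). 0 \<le> i \<and> i < int (length xs) \<and> i < e \<and> e < i + int (length xs) \<and> circ_arc xs i e \<in> H}"

lemma finite_member_arcs: "finite (member_arcs xs H)"
  by (rule finite_subset[of _ "{0..int (length xs)} \<times> {0..2 * int (length xs)}"]) (auto simp: member_arcs_def)

text \<open>From a fixed start an arc is determined by its size, so the arcs from \<open>i\<close>
  correspond to the members that are prefixes of \<open>rotate i xs\<close>. \<open>{}\<close> and
  \<open>set xs\<close> are prefixes of every rotation but not proper arcs, hence the
  exclusion.\<close>

lemma card_member_arcs:
  assumes "distinct xs" "H \<subseteq> Pow (set xs)" "{} \<notin> H" "set xs \<notin> H"
  shows "card (member_arcs xs H) = (\<Sum>i<length xs. card {A \<in> H. set (take (card A) (rotate i xs)) = A})"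
proof -
  let ?n = "length xs"
  let ?E = "\<lambda>i. {e. i < e \<and> e < i + int ?n \<and> circ_arc xs i e \<in> H}"
  have finE: "finite (?E i)" for i
    by (rule finite_subset[of _ "{i<..<i + int ?n}"]) auto
  have "member_arcs xs H = Sigma {0..<int ?n} ?E"
    by (auto simp: member_arcs_def)
  then have "card (member_arcs xs H) = (\<Sum>i\<in>{0..<int ?n}. card (?E i))"
    using finE by (simp add: card_SigmaI)
  also have "\<dots> = (\<Sum>i<?n. card (?E (int i)))"
    by (rule sum.reindex_bij_witness[of _ int nat]) auto
  also have "\<dots> = (\<Sum>i<?n. card {A \<in> H. set (take (card A) (rotate i xs)) = A})"
  proof (rule sum.cong)
    fix i assume i: "i \<in> {..<?n}"
    have size: "card A \<le> ?n" "card A \<noteq> 0" "card A \<noteq> ?n" if "A \<in> H" for A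
    proof -
      have A: "A \<subseteq> set xs" "finite A"
        using that assms(2) by (auto intro: finite_subset)
      then have "card A \<le> card (set xs)"
        by (intro card_mono) auto
      then show "card A \<le> ?n"
        using assms(1) by (simp add: distinct_card)
      show "card A \<noteq> 0"
        using A that assms(3) by auto
      show "card A \<noteq> ?n"
        using A that assms(1,4) card_subset_eq[of "set xs" A] by (auto simp: distinct_card)
    qed
    have "bij_betw (circ_arc xs (int i)) (?E (int i)) {A \<in> H. set (take (card A) (rotate i xs)) = A}"
    proof (rule bij_betw_byWitness[of _ "\<lambda>A. int i + int (card A)"])
      show "\<forall>e\<in>?E (int i). int i + int (card (circ_arc xs (int i) e)) = e"
        using card_circ_arc[OF assms(1)] by auto
      show "\<forall>A\<in>{A \<in> H. set (take (card A) (rotate i xs)) = A}. circ_arc xs (int i) (int i + int (card A)) = A"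
        using circ_arc_eq_prefix[of i xs] i size(1) by auto
      show "circ_arc xs (int i) ` ?E (int i) \<subseteq> {A \<in> H. set (take (card A) (rotate i xs)) = A}"
      proof (rule image_subsetI)
        fix e assume e: "e \<in> ?E (int i)"
        then have "card (circ_arc xs (int i) e) = nat (e - int i)"
          using card_circ_arc[OF assms(1)] by simp
        moreover have "nat (e - int i) \<le> ?n"
          using e by auto
        ultimately show "circ_arc xs (int i) e \<in> {A \<in> H. set (take (card A) (rotate i xs)) = A}"
          using circ_arc_eq_prefix[of i xs "nat (e - int i)"] i e by simp
      qed
      show "(\<lambda>A. int i + int (card A)) ` {A \<in> H. set (take (card A) (rotate i xs)) = A} \<subseteq> ?E (int i)"
      proof (rule image_subsetI)
        fix A assume A: "A \<in> {A \<in> H. set (take (card A) (rotate i xs)) = A}"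
        then have "circ_arc xs (int i) (int i + int (card A)) = A"
          using circ_arc_eq_prefix[of i xs "card A"] i size(1) by simp
        then show "int i + int (card A) \<in> ?E (int i)"
          using A size[of A] by auto
      qed
    qed
    then show "card (?E (int i)) = card {A \<in> H. set (take (card A) (rotate i xs)) = A}"
      by (rule bij_betw_same_card)
  qed simp
  finally show ?thesis .
qed

lemma bij_betw_rotate_permutations:
  "bij_betw (rotate i) (permutations_of_set S) (permutations_of_set S)"
proof -
  have "inj_on (rotate i) (permutations_of_set S)"
    unfolding rotate_def using inj_fn[OF inj_rotate1, of i] by (rule inj_on_subset) simp
  moreover have "rotate i ` permutations_of_set S \<subseteq> permutations_of_set S"
    by (auto dest: permutations_of_setD intro!: permutations_of_setI)
  ultimately show ?thesis
    by (simp add: bij_betw_def endo_inj_surj)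
qed

text \<open>Rotation maps the permutations of \<open>S\<close> bijectively to themselves, so every
  starting point contributes the same number of prefixes.\<close>

lemma sum_card_member_arcs:
  assumes "finite S" "H \<subseteq> Pow S" "{} \<notin> H" "S \<notin> H"
  shows "(\<Sum>xs\<in>permutations_of_set S. card (member_arcs xs H))
    = card S * (\<Sum>A\<in>H. fact (card A) * fact (card S - card A))"
proof -
  let ?\<Pi> = "permutations_of_set S"
  let ?c = "\<lambda>xs. card {A \<in> H. set (take (card A) xs) = A}"
  have finH: "finite H"
    using assms(1,2) by (meson finite_Pow_iff finite_subset)
  have "(\<Sum>xs\<in>?\<Pi>. card (member_arcs xs H)) = (\<Sum>xs\<in>?\<Pi>. \<Sum>i<card S. ?c (rotate i xs))"
  proof (rule sum.cong)
    fix xs assume xs: "xs \<in> ?\<Pi>"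
    then have "set xs = S" "distinct xs" "length xs = card S"
      by (auto dest: permutations_of_setD length_finite_permutations_of_set)
    then show "card (member_arcs xs H) = (\<Sum>i<card S. ?c (rotate i xs))"
      using card_member_arcs[of xs H] assms by simp
  qed simp
  also have "\<dots> = (\<Sum>i<card S. \<Sum>xs\<in>?\<Pi>. ?c (rotate i xs))"
    by (rule sum.swap)
  also have "\<dots> = (\<Sum>i<card S. \<Sum>xs\<in>?\<Pi>. ?c xs)"
    by (intro sum.cong refl sum.reindex_bij_betw[OF bij_betw_rotate_permutations])
  also have "(\<Sum>xs\<in>?\<Pi>. ?c xs) = (\<Sum>A\<in>H. card {xs \<in> ?\<Pi>. set (take (card A) xs) = A})"
    using finH by (intro sum_card_filter_swap) auto
  also have "\<dots> = (\<Sum>A\<in>H. fact (card A) * fact (card S - card A))"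
    using assms by (intro sum.cong) (auto simp: card_permutations_with_prefix)
  finally show ?thesis
    by simp
qed

text \<open>\<open>K\<close> only has to bound the sizes of the levels that occur in
  \<open>H\<close>, so different levels can be counted with different constants.\<close>

lemma sum_card_member_arcs_ge:
  assumes "finite S" "H \<subseteq> Pow S" "{} \<notin> H" "S \<notin> H"
    and K: "\<And>A. A \<in> H \<Longrightarrow> card S choose card A \<le> K"
  shows "card S * (card H * fact (card S)) \<le> K * (\<Sum>xs\<in>permutations_of_set S. card (member_arcs xs H))"
proof -
  let ?n = "card S"
  have "fact ?n \<le> K * (fact (card A) * fact (?n - card A))" if "A \<in> H" for A
  proof -
    have "card A \<le> ?n"
      using that assms(1,2) by (auto intro: card_mono)
    then have "fact ?n = (?n choose card A) * (fact (card A) * fact (?n - card A))"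
      using binomial_fact_lemma[of "card A" ?n] by (simp add: mult_ac)
    then show ?thesis
      using K[OF that] by simp
  qed
  then have "(\<Sum>A\<in>H. fact ?n) \<le> (\<Sum>A\<in>H. K * (fact (card A) * fact (?n - card A)))"
    by (intro sum_mono)
  then have "card H * fact ?n \<le> K * (\<Sum>A\<in>H. fact (card A) * fact (?n - card A))"
    by (simp add: sum_distrib_left)
  then have "?n * (card H * fact ?n) \<le> ?n * (K * (\<Sum>A\<in>H. fact (card A) * fact (?n - card A)))"
    by (rule mult_left_mono) simp
  then show ?thesis
    using sum_card_member_arcs[OF assms(1-4)] by (simp add: mult.left_commute)
qed

lemma arc_system_member_arcs:
  assumes "distinct xs" "xs \<noteq> []" and compl: "\<And>A. A \<in> G \<Longrightarrow> set xs - A \<in> G"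
  defines "P \<equiv> \<lambda>i e. i < e \<and> e < i + int (length xs) \<and> circ_arc xs i e \<in> G"
  shows "arc_system (int (length xs)) P" "member_arcs xs G = arc_system.arcs (int (length xs)) P"
proof -
  show sys: "arc_system (int (length xs)) P"
  proof
    show "P (i + int (length xs)) (e + int (length xs)) \<longleftrightarrow> P i e" for i e
      unfolding P_def circ_arc_shift by auto
    fix i e assume "P i e"
    then show "P e (i + int (length xs))"
      using circ_arc_compl[OF assms(1,2), of i e] compl by (simp add: P_def) metis
  qed (use assms(2) in \<open>auto simp: P_def\<close>)
  show "member_arcs xs G = arc_system.arcs (int (length xs)) P"
    unfolding arc_system.arcs_def[OF sys] by (auto simp: member_arcs_def P_def)
qed

text \<open>As the larger arc is not the whole circle, sizes are differences of end points, and
  different end points force a proper inclusion.\<close>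

lemma circ_arc_psubset:
  assumes "distinct xs" "i' \<le> i" "i < e" "e \<le> e'" "e' < i' + int (length xs)" "(i, e) \<noteq> (i', e')"
  shows "circ_arc xs i e \<subset> circ_arc xs i' e'"
proof -
  have "circ_arc xs i e \<subseteq> circ_arc xs i' e'"
    using assms by (auto simp: circ_arc_def)
  moreover have "card (circ_arc xs i e) \<noteq> card (circ_arc xs i' e')"
    using assms by (auto simp: card_circ_arc)
  ultimately show ?thesis
    unfolding psubset_eq by metis
qed

section \<open>Self-complementary families counted on circles\<close>

text \<open>With \<open>n = 2 * k + 1\<close> and at most \<open>n - 1\<close> arcs per circle,
  averaging gives \<open>n * card G \<le> (n - 1) * (n choose k)\<close>; by absorption the right
  side is \<open>n\<close> times the claimed bound.\<close>

lemma card_selfcompl_antichain_le: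
  assumes "finite S" "card S = n" "odd n" "n \<ge> 3" "G \<subseteq> Pow S" "{} \<notin> G" "S \<notin> G"
    and compl: "\<And>A. A \<in> G \<Longrightarrow> S - A \<in> G"
    and anti: "\<And>A B. A \<in> G \<Longrightarrow> B \<in> G \<Longrightarrow> \<not> A \<subset> B"
  shows "card G \<le> 2 * ((n - 1) choose ((n - 3) div 2))"
proof -
  let ?\<Pi> = "permutations_of_set S"
  define k where "k = n div 2"
  have k: "n = 2 * k + 1" "k > 0" "(n - 3) div 2 = k - 1"
    using assms(3,4) by (auto simp: k_def elim!: oddE)
  have "card (member_arcs xs G) \<le> n - 1" if "xs \<in> ?\<Pi>" for xs
  proof -
    let ?P = "\<lambda>i e. i < e \<and> e < i + int (length xs) \<and> circ_arc xs i e \<in> G"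
    have xs: "set xs = S" "distinct xs" "length xs = n" "xs \<noteq> []"
      using that assms(2,4) by (auto dest: permutations_of_setD length_finite_permutations_of_set)
    have sys: "arc_system (int (length xs)) ?P" "member_arcs xs G = arc_system.arcs (int (length xs)) ?P"
      using arc_system_member_arcs[OF xs(2,4), of G] compl xs(1) by auto
    have "int (card (member_arcs xs G)) \<le> int (length xs) - 1"
      unfolding sys(2)
    proof (rule arc_system.card_arcs_antichain_less[OF sys(1)])
      show "odd (int (length xs))"
        using xs assms(3) by simp
      fix i e e' assume P: "?P i e" "?P i e'"
      show "\<not> e < e'"
      proof
        assume "e < e'"
        then have "circ_arc xs i e \<subset> circ_arc xs i e'"
          using P by (intro circ_arc_psubset xs(2)) auto
        then show False
          using anti P by blast
      qed
    qed
    then show ?thesis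
      using xs(3) by linarith
  qed
  then have "(\<Sum>xs\<in>?\<Pi>. card (member_arcs xs G)) \<le> fact n * (n - 1)"
    using sum_bounded_above[of ?\<Pi> "\<lambda>xs. card (member_arcs xs G)" "n - 1"] assms(1,2) by simp
  then have "(n choose k) * (\<Sum>xs\<in>?\<Pi>. card (member_arcs xs G)) \<le> (n choose k) * (fact n * (n - 1))"
    by (rule mult_left_mono) simp
  moreover have "n * (card G * fact n) \<le> (n choose k) * (\<Sum>xs\<in>?\<Pi>. card (member_arcs xs G))"
    using sum_card_member_arcs_ge[OF assms(1,5,6,7), of "n choose k"] binomial_maximum[of n]
    unfolding k_def assms(2) by blast
  ultimately have "n * (card G * fact n) \<le> (n choose k) * (fact n * (n - 1))"
    by (rule le_trans[rotated])
  then have "fact n * (n * card G) \<le> fact n * ((n - 1) * (n choose k))"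
    by (simp only: mult_ac)
  then have "n * card G \<le> (n - 1) * (n choose k)"
    by simp
  also have "\<dots> = 2 * (k * (n choose k))"
    using k by simp
  also have "k * (n choose k) = n * ((n - 1) choose (k - 1))"
    using k by (intro times_binomial_minus1_eq) simp
  finally have "n * card G \<le> n * (2 * ((n - 1) choose (k - 1)))"
    by simp
  then have "card G \<le> 2 * ((n - 1) choose (k - 1))"
    using assms(4) by simp
  then show ?thesis
    using k(3) by simp
qed

text \<open>Half arcs carry weight \<open>M\<close>, all others \<open>M'\<close>, and
  \<open>m * M = (m + 1) * M'\<close>. At most \<open>2 * m\<close> half arcs lie on a circle, so
  their total extra weight is at most \<open>2 * M'\<close>. This is exactly the weight of the two
  arcs that must be missing when a half arc occurs.\<close>

lemma card_selfcompl_no_three_chain_le: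
  assumes "finite S" "card S = n" "n = 2 * m" "m \<ge> 1" "G \<subseteq> Pow S" "{} \<notin> G" "S \<notin> G"
    and compl: "\<And>A. A \<in> G \<Longrightarrow> S - A \<in> G"
    and no3: "\<And>A B C. A \<in> G \<Longrightarrow> B \<in> G \<Longrightarrow> C \<in> G \<Longrightarrow> A \<subset> B \<Longrightarrow> \<not> B \<subset> C"
  shows "card G \<le> 2 * (n choose (m - 1))"
proof -
  let ?\<Pi> = "permutations_of_set S"
  define G1 where "G1 = {A \<in> G. card A = m}"
  define G2 where "G2 = {A \<in> G. card A \<noteq> m}"
  define M where "M = n choose m"
  define M' where "M' = n choose (m - 1)"
  have M: "m * M = (m + 1) * M'"
  proof -
    have "m * M = n * ((n - 1) choose (m - 1))"
      unfolding M_def using assms(4) by (intro times_binomial_minus1_eq) simp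
    also have "\<dots> = (n - (m - 1)) * M'"
      unfolding M'_def by (rule binomial_absorb_comp[symmetric])
    also have "n - (m - 1) = m + 1"
      using assms(3,4) by simp
    finally show ?thesis .
  qed
  have M': "n choose a \<le> M'" if "a \<noteq> m" for a
  proof (cases "a < m")
    case True
    then show ?thesis
      unfolding M'_def using assms(3) by (intro binomial_mono) auto
  next
    case False
    show ?thesis
    proof (cases "a \<le> n")
      case True
      then have "n choose a = n choose (n - a)"
        by (rule binomial_symmetric)
      also have "\<dots> \<le> M'"
        unfolding M'_def using assms(3) False that by (intro binomial_mono) auto
      finally show ?thesis .
    qed (simp add: binomial_eq_0)
  qed
  \<comment> \<open>The factor \<open>m\<close> allows \<open>M\<close> to be traded for
    \<open>M'\<close> without fractions.\<close>
  have per_cycle: "m * (M * card (member_arcs xs G1) + M' * card (member_arcs xs G2)) \<le> m * (2 * n * M')"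
    if "xs \<in> ?\<Pi>" for xs
  proof -
    let ?P = "\<lambda>i e. i < e \<and> e < i + int (length xs) \<and> circ_arc xs i e \<in> G"
    have xs: "set xs = S" "distinct xs" "length xs = n" "xs \<noteq> []"
      using that assms(2-4) by (auto dest: permutations_of_setD length_finite_permutations_of_set)
    have sys: "arc_system (int (length xs)) ?P" "member_arcs xs G = arc_system.arcs (int (length xs)) ?P"
      using arc_system_member_arcs[OF xs(2,4), of G] compl xs(1) by auto
    interpret arc_system "int (length xs)" ?P
      by (rule sys(1))
    have no3': "(i', e') = (i'', e'')"
      if "?P i e" "?P i' e'" "?P i'' e''" "i' \<le> i" "e \<le> e'" "(i, e) \<noteq> (i', e')" "i'' \<le> i'" "e' \<le> e''"
      for i i' i'' e e' e''
    proof (rule ccontr)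
      assume "(i', e') \<noteq> (i'', e'')"
      then have "circ_arc xs i' e' \<subset> circ_arc xs i'' e''"
        using that by (intro circ_arc_psubset xs(2)) auto
      moreover have "circ_arc xs i e \<subset> circ_arc xs i' e'"
        using that by (intro circ_arc_psubset xs(2)) auto
      ultimately show False
        using no3 that(1-3) by blast
    qed
    let ?N1 = "card (member_arcs xs G1)" and ?N2 = "card (member_arcs xs G2)"
    have N: "card (member_arcs xs G) = ?N1 + ?N2"
    proof -
      have "member_arcs xs G = member_arcs xs G1 \<union> member_arcs xs G2"
        by (auto simp: member_arcs_def G1_def G2_def)
      moreover have "member_arcs xs G1 \<inter> member_arcs xs G2 = {}"
        by (auto simp: member_arcs_def G1_def G2_def)
      ultimately show ?thesis
        by (simp add: card_Un_disjoint finite_member_arcs)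
    qed
    have "card (member_arcs xs G) \<le> (\<Sum>i\<in>{0..<int (length xs)}. 2)"
      unfolding sys(2) card_arcs by (intro sum_mono ends_le_two[OF no3'])
    then have le: "?N1 + ?N2 \<le> 2 * n"
      using N xs(3) by simp
    have ev: "even (?N1 + ?N2)"
      using even_card_arcs unfolding sys(2)[symmetric] N .
    have G1_arc: "e = i + int m \<and> ?P i (i + int m) \<and> i \<in> {0..<int n}" if "(i, e) \<in> member_arcs xs G1" for i e
    proof -
      have "i < e" "e < i + int n" "card (circ_arc xs i e) = m" "circ_arc xs i e \<in> G" "i \<in> {0..<int n}"
        using that xs(3) by (auto simp: member_arcs_def G1_def)
      moreover from this have "e = i + int m"
        using card_circ_arc[OF xs(2), of i e] xs(3) by simp
      ultimately show ?thesis
        using xs(3) by simp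
    qed
    show ?thesis
    proof (cases "member_arcs xs G1 = {}")
      case True
      then show ?thesis
        using le by simp
    next
      case False
      then obtain i e where "(i, e) \<in> member_arcs xs G1"
        by auto
      then have i: "?P i (i + int m)"
        using G1_arc by blast
      have "int (card (member_arcs xs G)) \<noteq> 2 * int (length xs)"
      proof
        assume "int (card (member_arcs xs G)) = 2 * int (length xs)"
        then have "\<not> ?P i (i + int m) \<or> 2 * int m \<noteq> int (length xs)"
          unfolding sys(2) by (rule no_half_arc[rotated]) (rule no3')
        then show False
          using i xs(3) assms(3) by auto
      qed
      then have "?N1 + ?N2 \<noteq> 2 * n"
        using N xs(3) by simp
      \<comment> \<open>Parity turns one missing arc into two.\<close>
      then have le': "?N1 + ?N2 \<le> 2 * n - 2"
        using le ev by presburger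
      have "member_arcs xs G1 \<subseteq> (\<lambda>i. (i, i + int m)) ` {0..<int n}"
        using G1_arc by auto
      then have "?N1 \<le> card {0..<int n}"
        by (intro surj_card_le) auto
      then have N1: "?N1 \<le> 2 * m"
        using assms(3) by simp
      have "m * (M * ?N1 + M' * ?N2) = (m * M) * ?N1 + m * M' * ?N2"
        by (simp add: distrib_left mult.assoc)
      also have "\<dots> = M' * (m * (?N1 + ?N2) + ?N1)"
        unfolding M by (simp add: algebra_simps)
      also have "\<dots> \<le> M' * (m * (2 * n - 2) + 2 * m)"
        by (intro mult_left_mono add_mono N1 mult_left_mono[OF le']) auto
      also have "m * (2 * n - 2) + 2 * m = m * (2 * n)"
        using assms(3,4) by (simp add: diff_mult_distrib2)
      finally show ?thesis
        by (simp add: mult_ac)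
    qed
  qed
  have G12: "G1 \<subseteq> Pow S" "{} \<notin> G1" "S \<notin> G1" "G2 \<subseteq> Pow S" "{} \<notin> G2" "S \<notin> G2"
    using assms(5-7) by (auto simp: G1_def G2_def)
  have "n * (card G1 * fact n) \<le> M * (\<Sum>xs\<in>?\<Pi>. card (member_arcs xs G1))"
    using sum_card_member_arcs_ge[OF assms(1) G12(1-3), of M] by (auto simp: G1_def M_def assms(2))
  moreover have "n * (card G2 * fact n) \<le> M' * (\<Sum>xs\<in>?\<Pi>. card (member_arcs xs G2))"
    using sum_card_member_arcs_ge[OF assms(1) G12(4-6), of M'] M' by (auto simp: G2_def assms(2))
  moreover have "card G = card G1 + card G2"
  proof -
    have "G = G1 \<union> G2" "G1 \<inter> G2 = {}"
      by (auto simp: G1_def G2_def)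
    moreover have "finite G"
      using assms(1,5) by (meson finite_Pow_iff finite_subset)
    ultimately show ?thesis
      by (metis card_Un_disjoint finite_Un)
  qed
  ultimately have "n * (card G * fact n)
     \<le> M * (\<Sum>xs\<in>?\<Pi>. card (member_arcs xs G1)) + M' * (\<Sum>xs\<in>?\<Pi>. card (member_arcs xs G2))"
    by (simp add: algebra_simps)
  also have "\<dots> = (\<Sum>xs\<in>?\<Pi>. M * card (member_arcs xs G1) + M' * card (member_arcs xs G2))"
    by (simp add: sum.distrib sum_distrib_left)
  also have "\<dots> \<le> (\<Sum>xs\<in>?\<Pi>. 2 * n * M')"
  proof (rule sum_mono)
    fix xs assume "xs \<in> ?\<Pi>"
    from per_cycle[OF this] show "M * card (member_arcs xs G1) + M' * card (member_arcs xs G2) \<le> 2 * n * M'"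
      using assms(4) by (subst (asm) nat_mult_le_cancel1) auto
  qed
  also have "\<dots> = fact n * (2 * n * M')"
    using assms(1,2) by simp
  finally have "(n * fact n) * card G \<le> (n * fact n) * (2 * M')"
    by (simp add: mult_ac)
  moreover have "n > 0"
    using assms(3,4) by simp
  ultimately show ?thesis
    by (simp add: M'_def)
qed

section \<open>Exact values\<close>

lemma upper_half_sum_even: "2 * (\<Sum>i = m..2 * m. 2 * m choose i) = 2 ^ (2 * m) + (2 * m choose m)"
proof -
  let ?c = "\<lambda>i. 2 * m choose i"
  have sym: "(\<Sum>i = m..2 * m. ?c i) = (\<Sum>i\<le>m. ?c i)"
    by (rule sum.reindex_bij_witness[of _ "\<lambda>i. 2 * m - i" "\<lambda>i. 2 * m - i"]) (auto simp: binomial_symmetric[symmetric])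
  have "{..2 * m} = {..<m} \<union> {m..2 * m}"
    by auto
  then have "(\<Sum>i\<le>2 * m. ?c i) = (\<Sum>i<m. ?c i) + (\<Sum>i = m..2 * m. ?c i)"
    by (simp add: sum.union_disjoint ivl_disj_int)
  moreover have "(\<Sum>i\<le>m. ?c i) = (\<Sum>i<m. ?c i) + ?c m"
    by (simp add: lessThan_Suc_atMost[symmetric])
  ultimately show ?thesis
    using sym by (simp add: choose_row_sum)
qed

lemma upper_half_sum_odd: "(\<Sum>i = Suc k..2 * k + 1. (2 * k + 1) choose i) = 2 ^ (2 * k)"
proof -
  have "(\<Sum>i = Suc k..2 * k + 1. (2 * k + 1) choose i) = (\<Sum>i\<le>k. (2 * k + 1) choose i)"
    by (rule sum.reindex_bij_witness[of _ "\<lambda>i. 2 * k + 1 - i" "\<lambda>i. 2 * k + 1 - i"])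
      (auto simp: binomial_symmetric[symmetric])
  then show ?thesis
    by (simp only: binomial_r_part_sum)
qed

lemma central_binomial_even:
  assumes "m \<ge> 1"
  shows "2 * m choose m = 2 * ((2 * m - 1) choose (m - 1))"
proof -
  have "m * (2 * m choose m) = m * (2 * ((2 * m - 1) choose (m - 1)))"
    using times_binomial_minus1_eq[of m "2 * m"] assms by (simp only: mult_ac)
  then show ?thesis
    using assms by simp
qed

lemma next_to_central_binomial_even:
  assumes "m \<ge> 1"
  shows "(m + 1) * (2 * m choose (m - 1)) = m * (2 * m choose m)"
proof -
  have "2 * m - (m - 1) = m + 1"
    using assms by simp
  then have "(m + 1) * (2 * m choose (m - 1)) = 2 * m * ((2 * m - 1) choose (m - 1))"
    using binomial_absorb_comp[of "2 * m" "m - 1"] by (simp only:)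
  also have "\<dots> = m * (2 * m choose m)"
    using assms by (intro times_binomial_minus1_eq[symmetric]) simp
  finally show ?thesis .
qed

lemma proper_core_inclusion:
  assumes "finite S" "F \<subseteq> Pow S"
  shows "proper_core S F \<subseteq> Pow S" "finite (proper_core S F)" "{} \<notin> proper_core S F" "S \<notin> proper_core S F"
    "finite {A \<in> proper_core S F. Q A}"
proof -
  show *: "proper_core S F \<subseteq> Pow S" "{} \<notin> proper_core S F" "S \<notin> proper_core S F"
    using assms(2) by (auto simp: proper_core_def compl_core_def)
  show "finite (proper_core S F)"
    by (rule finite_subset[OF *(1)]) (use assms(1) in simp)
  then show "finite {A \<in> proper_core S F. Q A}"
    by simp
qed

text \<open>The empty set alone forms a first group that meets nothing, so fewer than
  \<open>t\<close> other members can exist.\<close>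

lemma card_le_or_empty_notin:
  assumes "finite F" "union_intersecting 1 t F"
  shows "card F \<le> t \<or> {} \<notin> F"
proof (rule ccontr)
  assume *: "\<not> ?thesis"
  then have "\<exists>A\<in>{{}}. \<exists>B\<in>F - {{}}. A \<inter> B \<noteq> {}"
    using assms(1) by (intro union_intersectingD[OF assms(2)]) auto
  then show False
    by simp
qed

text \<open>The empty set can fill one place of the first group without changing its union.\<close>

lemma union_intersecting_remove_empty:
  assumes "union_intersecting (Suc s) t F" "{} \<in> F"
  shows "union_intersecting s t (F - {{}})"
  unfolding union_intersecting_iff
proof (intro allI impI)
  fix X Y
  assume *: "X \<subseteq> F - {{}} \<and> Y \<subseteq> F - {{}} \<and> finite X \<and> finite Y \<and> card X = s \<and> card Y = t \<and> X \<inter> Y = {}"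
  then have "{} \<notin> X" "{} \<notin> Y"
    by auto
  then have "\<exists>A\<in>insert {} X. \<exists>B\<in>Y. A \<inter> B \<noteq> {}"
    using * assms(2) by (intro union_intersectingD[OF assms(1)]) auto
  then show "\<Union>X \<inter> \<Union>Y \<noteq> {}"
    by blast
qed

text \<open>\<open>K\<close> is any bound on self-complementary antichains, so that even and odd
  \<open>n\<close> differ only in this bound. A system containing \<open>{}\<close> has at most two
  members.\<close>

lemma card_one_two_le:
  assumes "n \<ge> 3" "F \<subseteq> Pow {1..n}" "union_intersecting 1 2 F"
    and K: "\<And>G. G \<subseteq> Pow {1..n} \<Longrightarrow> {} \<notin> G \<Longrightarrow> {1..n} \<notin> G \<Longrightarrow> (\<And>A. A \<in> G \<Longrightarrow> {1..n} - A \<in> G)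
       \<Longrightarrow> (\<And>A B. A \<in> G \<Longrightarrow> B \<in> G \<Longrightarrow> \<not> A \<subset> B) \<Longrightarrow> card G \<le> K"
  shows "2 * card F \<le> 2 ^ n + K"
proof (cases "{} \<in> F")
  case True
  have "finite F"
    using assms(2) by (rule finite_subset) simp
  then have "card F \<le> 2"
    using card_le_or_empty_notin[OF _ assms(3)] True by simp
  moreover have "(2::nat) ^ 3 \<le> 2 ^ n"
    using assms(1) by (intro power_increasing) auto
  ultimately show ?thesis
    by simp
next
  case False
  let ?G = "proper_core {1..n} F"
  note G = proper_core_inclusion[OF finite_atLeastAtMost assms(2)]
  have "card ?G \<le> K"
  proof (rule K)
    show "{1..n} - A \<in> ?G" if "A \<in> ?G" for A
      using that by (rule proper_core_compl[OF assms(2)])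
    show "\<not> A \<subset> B" if "A \<in> ?G" "B \<in> ?G" for A B
    proof -
      have "card {B \<in> ?G. A \<subset> B} = 0"
        using proper_core_few[OF _ assms(2,3) that(1)] by simp
      then have "{B \<in> ?G. A \<subset> B} = {}"
        using G(5) by (simp only: card_0_eq)
      then show ?thesis
        using that by blast
    qed
  qed (use G in auto)
  then show ?thesis
    using card_le_proper_core'[OF _ assms(2) False] by simp
qed

lemma card_one_two_le_even:
  assumes "m \<ge> 2" "F \<subseteq> Pow {1..2 * m}" "union_intersecting 1 2 F"
  shows "2 * card F \<le> 2 ^ (2 * m) + (2 * m choose m)"
proof (rule card_one_two_le[OF _ assms(2,3)])
  fix G assume "G \<subseteq> Pow {1..2 * m}" "\<And>A B. A \<in> G \<Longrightarrow> B \<in> G \<Longrightarrow> \<not> A \<subset> B"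
  then show "card G \<le> 2 * m choose m"
    using sperner[of "{1..2 * m}" G "2 * m"] assms(1) by simp
qed (use assms(1) in simp)

lemma card_one_two_le_odd:
  assumes "k \<ge> 1" "F \<subseteq> Pow {1..2 * k + 1}" "union_intersecting 1 2 F"
  shows "card F \<le> 2 ^ (2 * k) + (2 * k choose (k - 1))"
proof -
  have k: "(2 * k - 2) div 2 = k - 1"
    using assms(1) by simp
  have "2 * card F \<le> 2 ^ (2 * k + 1) + 2 * (2 * k choose (k - 1))"
  proof (rule card_one_two_le[OF _ assms(2,3)])
    fix G
    assume "G \<subseteq> Pow {1..2 * k + 1}" "{} \<notin> G" "{1..2 * k + 1} \<notin> G" "\<And>A. A \<in> G \<Longrightarrow> {1..2 * k + 1} - A \<in> G"
      "\<And>A B. A \<in> G \<Longrightarrow> B \<in> G \<Longrightarrow> \<not> A \<subset> B"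
    then show "card G \<le> 2 * (2 * k choose (k - 1))"
      using card_selfcompl_antichain_le[of "{1..2 * k + 1}" "2 * k + 1" G] assms(1) k by simp
  qed (use assms(1) in simp)
  then show ?thesis
    by simp
qed

lemma card_one_three_le:
  assumes "n \<ge> 3" "F \<subseteq> Pow {1..n}" "union_intersecting 1 3 F"
  shows "card F \<le> 2 ^ (n - 1) + ((n - 1) choose ((n - 1) div 2))"
proof (cases "{} \<in> F")
  case True
  have "finite F"
    using assms(2) by (rule finite_subset) simp
  then have "card F \<le> 3"
    using card_le_or_empty_notin[OF _ assms(3)] True by simp
  moreover have "(2::nat) ^ 2 \<le> 2 ^ (n - 1)"
    using assms(1) by (intro power_increasing) auto
  ultimately show ?thesis
    by simp
next
  case False
  let ?G = "proper_core {1..n} F"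
  note G = proper_core_inclusion[OF finite_atLeastAtMost assms(2)]
  \<comment> \<open>Both orders of the groups are used: one bounds the members above a set, the
    other those below it.\<close>
  have ui': "union_intersecting 3 1 F"
    using assms(3) by (simp add: union_intersecting_commute)
  have unique: "A = A'" if "card {A. Q A} \<le> 1" "finite {A. Q A}" "Q A" "Q A'" for Q and A A' :: "nat set"
    using that by (metis One_nat_def card_le_Suc0_iff_eq mem_Collect_eq)
  have "card ?G \<le> 2 * ((n - 1) choose ((n - 1) div 2))"
  proof (rule card_matched_le)
    fix A A' B assume "A \<in> ?G" "A' \<in> ?G" "B \<in> ?G" "A \<subset> B" "A' \<subset> B"
    then show "A = A'"
      using proper_core_few[OF _ assms(2) ui', of B] unique[of "\<lambda>A. A \<in> ?G \<and> A \<subset> B"] G(5) by simp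
  next
    fix A B B' assume "A \<in> ?G" "B \<in> ?G" "B' \<in> ?G" "A \<subset> B" "A \<subset> B'"
    then show "B = B'"
      using proper_core_few[OF _ assms(2,3), of A] unique[of "\<lambda>B. B \<in> ?G \<and> A \<subset> B"] G(5) by simp
  qed (use G assms(1) in auto)
  then have "2 * card F \<le> 2 ^ n + 2 * ((n - 1) choose ((n - 1) div 2))"
    using card_le_proper_core'[OF _ assms(2) False] by simp
  moreover have "(2::nat) ^ n = 2 * 2 ^ (n - 1)"
    using assms(1) by (simp add: power_eq_if)
  ultimately show ?thesis
    by simp
qed

lemma proper_core_no_three_chain:
  assumes "finite S" "F \<subseteq> Pow S" "union_intersecting 2 2 F"
    and "A \<in> proper_core S F" "B \<in> proper_core S F" "C \<in> proper_core S F" "A \<subset> B"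
  shows "\<not> B \<subset> C"
proof
  assume "B \<subset> C"
  let ?G = "proper_core S F"
  have "{A \<in> ?G. A \<subset> B} \<noteq> {}" "{C \<in> ?G. B \<subset> C} \<noteq> {}"
    using assms \<open>B \<subset> C\<close> by auto
  then have "card {A \<in> ?G. A \<subset> B} > 0" "card {C \<in> ?G. B \<subset> C} > 0"
    using proper_core_inclusion(5)[OF assms(1,2)] by (simp_all only: card_gt_0_iff) auto
  then show False
    using proper_core_few[OF assms(1-3,5)] by simp
qed

text \<open>Removing \<open>{}\<close> leaves a (1,2) system, whose bound is smaller by
  \<open>2 * k choose k\<close>, enough to pay for the removed set. Without \<open>{}\<close>, the
  core has no chain of three.\<close>

lemma card_two_two_le_odd:
  assumes "k \<ge> 1" "F \<subseteq> Pow {1..2 * k + 1}" "union_intersecting 2 2 F"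
  shows "card F \<le> 2 ^ (2 * k) + ((2 * k + 1) choose k)"
proof (cases "{} \<in> F")
  case True
  then have "union_intersecting 1 2 (F - {{}})"
    using union_intersecting_remove_empty[of 1 2 F] assms(3) by (simp add: numeral_2_eq_2)
  then have "card (F - {{}}) \<le> 2 ^ (2 * k) + (2 * k choose (k - 1))"
    using assms(1,2) by (intro card_one_two_le_odd) auto
  moreover have "card (F - {{}}) = card F - 1"
    using True by (simp add: card_Diff_singleton)
  moreover have "(2 * k + 1) choose k = (2 * k choose (k - 1)) + (2 * k choose k)"
    using assms(1) choose_reduce_nat[of "2 * k + 1" k] by simp
  moreover have "2 * k choose k > 0"
    by simp
  ultimately show ?thesis
    by linarith
next
  case False
  let ?S = "{1..2 * k + 1}"
  note G = proper_core_inclusion[OF finite_atLeastAtMost assms(2)]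
  have "card (proper_core ?S F) \<le> 2 * ((2 * k + 1) choose ((2 * k + 1) div 2))"
  proof (rule card_no_three_chain_le[of ?S])
    fix A B C assume "A \<in> proper_core ?S F" "B \<in> proper_core ?S F" "C \<in> proper_core ?S F" "A \<subset> B"
    then show "\<not> B \<subset> C"
      by (rule proper_core_no_three_chain[OF _ assms(2,3), rotated]) simp
  qed (use G(1) assms(1) in simp_all)
  then show ?thesis
    using card_le_proper_core'[OF _ assms(2) False] by simp
qed

text \<open>Removing \<open>{}\<close> again leaves a (1,2) system; after doubling, Pascal's rule
  shows a slack of \<open>2 * ((2 * m - 1) choose (m - 2))\<close>, at least the 2 that the removed
  set costs.\<close>

lemma card_two_two_le_even:
  assumes "m \<ge> 2" "F \<subseteq> Pow {1..2 * m}" "union_intersecting 2 2 F"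
  shows "2 * card F \<le> 2 ^ (2 * m) + 2 * (2 * m choose (m - 1))"
proof (cases "{} \<in> F")
  case True
  then have "union_intersecting 1 2 (F - {{}})"
    using union_intersecting_remove_empty[of 1 2 F] assms(3) by (simp add: numeral_2_eq_2)
  then have "2 * card (F - {{}}) \<le> 2 ^ (2 * m) + (2 * m choose m)"
    using assms(1,2) by (intro card_one_two_le_even) auto
  moreover have "card (F - {{}}) = card F - 1"
    using True by (simp add: card_Diff_singleton)
  moreover have "2 * m choose m = 2 * ((2 * m - 1) choose (m - 1))"
    using assms(1) by (intro central_binomial_even) simp
  moreover have "2 * m choose (m - 1) = ((2 * m - 1) choose (m - 2)) + ((2 * m - 1) choose (m - 1))"
    using assms(1) choose_reduce_nat[of "2 * m" "m - 1"] by (simp add: numeral_2_eq_2)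
  moreover have "(2 * m - 1) choose (m - 2) > 0"
    by simp
  ultimately show ?thesis
    by linarith
next
  case False
  let ?S = "{1..2 * m}"
  note G = proper_core_inclusion[OF finite_atLeastAtMost assms(2)]
  have "card (proper_core ?S F) \<le> 2 * (2 * m choose (m - 1))"
  proof (rule card_selfcompl_no_three_chain_le[of ?S])
    fix A B C assume "A \<in> proper_core ?S F" "B \<in> proper_core ?S F" "C \<in> proper_core ?S F" "A \<subset> B"
    then show "\<not> B \<subset> C"
      by (rule proper_core_no_three_chain[OF _ assms(2,3), rotated]) simp
  next
    fix A assume "A \<in> proper_core ?S F"
    then show "?S - A \<in> proper_core ?S F"
      by (rule proper_core_compl[OF assms(2)])
  qed (use G assms(1) in simp_all)
  then show ?thesis
    using card_le_proper_core'[OF _ assms(2) False] by simp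
qed

section \<open>Extremal systems and the exact values\<close>

lemma card_large_subsets: "card {A. A \<subseteq> {1..n} \<and> p \<le> card A} = (\<Sum>i = p..n. n choose i)"
proof -
  have "{A. A \<subseteq> {1..n} \<and> p \<le> card A} = {A. A \<subseteq> {1..n} \<and> card A \<in> {p..n}}"
    using card_mono[of "{1..n}"] by fastforce
  then show ?thesis
    by (simp only: card_subsets_by_size[OF finite_atLeastAtMost finite_atLeastAtMost]) simp
qed

lemma card_subsets_without:
  assumes "n \<ge> 1"
  shows "card {A. A \<subseteq> {1..n} \<and> card A = p \<and> 1 \<notin> A} = (n - 1) choose p"
proof -
  have "{A. A \<subseteq> {1..n} \<and> card A = p \<and> 1 \<notin> A} = {A. A \<subseteq> {1..n} - {1} \<and> card A = p}"
    by auto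
  moreover have "card ({1..n} - {1}) = n - 1"
    using assms by (subst card_Diff_singleton) auto
  ultimately show ?thesis
    using n_subsets[of "{1..n} - {1}" p] by simp
qed

lemma card_subsets_with:
  assumes "n \<ge> 1" "p \<ge> 1"
  shows "card {A. A \<subseteq> {1..n} \<and> card A = p \<and> 1 \<in> A} = (n - 1) choose (p - 1)"
proof -
  let ?X = "{A. A \<subseteq> {1..n} \<and> card A = p \<and> 1 \<in> A}" and ?Y = "{A. A \<subseteq> {1..n} \<and> card A = p \<and> 1 \<notin> A}"
  have "finite ?X" "finite ?Y"
    by (rule finite_subset[of _ "Pow {1..n}"], auto)+
  moreover have "?X \<inter> ?Y = {}"
    by auto
  ultimately have "card (?X \<union> ?Y) = card ?X + card ?Y"
    by (rule card_Un_disjoint)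
  moreover have "?X \<union> ?Y = {A. A \<subseteq> {1..n} \<and> card A = p}"
    by auto
  moreover have "card {A. A \<subseteq> {1..n} \<and> card A = p} = n choose p"
    using n_subsets[of "{1..n}" p] by simp
  moreover have "n choose p = ((n - 1) choose (p - 1)) + ((n - 1) choose p)"
    using assms choose_reduce_nat[of n p] by simp
  ultimately show ?thesis
    using card_subsets_without[OF assms(1), of p] by simp
qed

lemma card_large_subsets_extended:
  assumes "\<And>A. A \<in> E \<Longrightarrow> A \<subseteq> {1..n} \<and> card A < p"
  shows "card ({A. A \<subseteq> {1..n} \<and> p \<le> card A} \<union> E) = (\<Sum>i = p..n. n choose i) + card E"
proof -
  have "finite E"
    by (rule finite_subset[of _ "Pow {1..n}"]) (use assms in auto)
  moreover have "finite {A. A \<subseteq> {1..n} \<and> p \<le> card A}"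
    by (rule finite_subset[of _ "Pow {1..n}"]) auto
  moreover have "{A. A \<subseteq> {1..n} \<and> p \<le> card A} \<inter> E = {}"
    using assms by fastforce
  ultimately show ?thesis
    by (simp only: card_Un_disjoint card_large_subsets)
qed

lemma union_intersecting_oneI:
  assumes "finite F" "\<And>A. A \<in> F \<Longrightarrow> card {B \<in> F. A \<inter> B = {}} < t"
  shows "union_intersecting 1 t F"
  unfolding union_intersecting_iff
proof (intro allI impI notI)
  fix X Y
  assume *: "X \<subseteq> F \<and> Y \<subseteq> F \<and> finite X \<and> finite Y \<and> card X = 1 \<and> card Y = t \<and> X \<inter> Y = {}"
    and disj: "\<Union>X \<inter> \<Union>Y = {}"
  then obtain A where A: "X = {A}" "A \<in> F"
    by (auto simp: card_1_singleton_iff)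
  then have "Y \<subseteq> {B \<in> F. A \<inter> B = {}}"
    using * disj by auto
  then have "card Y \<le> card {B \<in> F. A \<inter> B = {}}"
    using assms(1) by (intro card_mono) auto
  then show False
    using assms(2)[OF A(2)] * by simp
qed

lemma card_disjoint_le:
  assumes "A \<subseteq> {1..n}" "B \<subseteq> {1..n}" "A \<inter> B = {}"
  shows "card A + card B \<le> n" "card A + card B = n \<Longrightarrow> B = {1..n} - A"
proof -
  have fin: "finite A" "finite B"
    using assms finite_subset by (metis finite_atLeastAtMost)+
  have "card (A \<union> B) \<le> card {1..n}"
    using assms by (intro card_mono) auto
  then show "card A + card B \<le> n"
    using card_Un_disjoint[OF fin assms(3)] by simp
  assume "card A + card B = n"
  then have "A \<union> B = {1..n}"
    using card_Un_disjoint[OF fin assms(3)] assms by (intro card_subset_eq) auto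
  then show "B = {1..n} - A"
    using assms by auto
qed

text \<open>Disjoint members are complementary here, so each member has at most one disjoint
  partner.\<close>

lemma union_intersecting_one_twoI:
  assumes "F \<subseteq> Pow {1..n}" and "\<And>A B. A \<in> F \<Longrightarrow> B \<in> F \<Longrightarrow> A \<inter> B = {} \<Longrightarrow> card A + card B = n"
  shows "union_intersecting 1 2 F"
proof (rule union_intersecting_oneI)
  show "finite F"
    using assms(1) by (rule finite_subset) simp
  fix A assume A: "A \<in> F"
  have "{B \<in> F. A \<inter> B = {}} \<subseteq> {{1..n} - A}"
  proof clarify
    fix B assume "B \<in> F" "A \<inter> B = {}"
    then show "B = {1..n} - A"
      using A assms by (intro card_disjoint_le) auto
  qed
  then have "card {B \<in> F. A \<inter> B = {}} \<le> card {{1..n} - A}"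
    by (intro card_mono) auto
  then show "card {B \<in> F. A \<inter> B = {}} < 2"
    by simp
qed

lemma max_one_one:
  assumes "n \<ge> 1"
  shows "max_union_intersecting n 1 1 = 2 ^ (n - 1)"
proof (rule antisym)
  have pow: "(2::nat) ^ n = 2 * 2 ^ (n - 1)"
    using assms by (simp add: power_eq_if)
  show "max_union_intersecting n 1 1 \<le> 2 ^ (n - 1)"
  proof (rule max_union_intersecting_le)
    fix F assume F: "F \<subseteq> Pow {1..n}" "union_intersecting 1 1 F"
    have "compl_core {1..n} F = {}"
    proof (rule ccontr)
      assume "compl_core {1..n} F \<noteq> {}"
      then obtain A where A: "A \<in> F" "{1..n} - A \<in> F"
        by (auto simp: compl_core_def)
      have "1 \<in> {1..n}"
        using assms by simp
      then have "A \<noteq> {1..n} - A"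
        by blast
      then have "\<exists>A'\<in>{A}. \<exists>B\<in>{{1..n} - A}. A' \<inter> B \<noteq> {}"
        using A by (intro union_intersectingD[OF F(2)]) auto
      then show False
        by auto
    qed
    then show "card F \<le> 2 ^ (n - 1)"
      using card_le_compl_core[OF _ F(1)] pow by simp
  qed simp
  \<comment> \<open>The sets containing 1, written as a difference to be counted by
    subtraction.\<close>
  let ?F = "Pow {1..n} - Pow ({1..n} - {1})"
  have "card ?F = 2 ^ n - 2 ^ (n - 1)"
    using assms by (subst card_Diff_subset) (auto simp: card_Pow card_Diff_singleton)
  moreover have "union_intersecting 1 1 ?F"
  proof (rule union_intersecting_oneI)
    fix A assume "A \<in> ?F"
    then have "{B \<in> ?F. A \<inter> B = {}} = {}"
      by auto
    then show "card {B \<in> ?F. A \<inter> B = {}} < 1"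
      by (simp only: card.empty)
  qed simp
  ultimately show "2 ^ (n - 1) \<le> max_union_intersecting n 1 1"
    using max_union_intersecting_ge[of ?F n 1 1] pow by auto
qed

lemma max_one_two_even:
  assumes "m \<ge> 2"
  shows "max_union_intersecting (2 * m) 1 2 = (\<Sum>i = m..2 * m. 2 * m choose i)"
proof (rule antisym)
  show "max_union_intersecting (2 * m) 1 2 \<le> (\<Sum>i = m..2 * m. 2 * m choose i)"
  proof (rule max_union_intersecting_le)
    fix F assume "F \<subseteq> Pow {1..2 * m}" "union_intersecting 1 2 F"
    then show "card F \<le> (\<Sum>i = m..2 * m. 2 * m choose i)"
      using card_one_two_le_even[OF assms, of F] upper_half_sum_even[of m] by linarith
  qed simp
  let ?F = "{A. A \<subseteq> {1..2 * m} \<and> m \<le> card A}"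
  have "union_intersecting 1 2 ?F"
  proof (rule union_intersecting_one_twoI[of _ "2 * m"])
    fix A B assume "A \<in> ?F" "B \<in> ?F" "A \<inter> B = {}"
    then show "card A + card B = 2 * m"
      using card_disjoint_le(1)[of A "2 * m" B] by auto
  qed auto
  then show "(\<Sum>i = m..2 * m. 2 * m choose i) \<le> max_union_intersecting (2 * m) 1 2"
    using max_union_intersecting_ge[of ?F "2 * m" 1 2] card_large_subsets[where n = "2 * m" and p = m] by auto
qed

lemma max_one_two_odd:
  assumes "k \<ge> 1"
  shows "max_union_intersecting (2 * k + 1) 1 2 = 2 ^ (2 * k) + (2 * k choose (k - 1))"
proof (rule antisym)
  show "max_union_intersecting (2 * k + 1) 1 2 \<le> 2 ^ (2 * k) + (2 * k choose (k - 1))"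
    using card_one_two_le_odd[OF assms] by (intro max_union_intersecting_le) auto
  let ?n = "2 * k + 1"
  \<comment> \<open>Any two of these \<open>k\<close>-sets meet in 1, so a disjoint pair of members
    involves a larger set and fills the ground set.\<close>
  let ?E = "{A. A \<subseteq> {1..?n} \<and> card A = k \<and> 1 \<in> A}"
  let ?F = "{A. A \<subseteq> {1..?n} \<and> Suc k \<le> card A} \<union> ?E"
  have "card ?F = (\<Sum>i = Suc k..?n. ?n choose i) + card ?E"
    by (rule card_large_subsets_extended) auto
  also have "\<dots> = 2 ^ (2 * k) + (2 * k choose (k - 1))"
    using card_subsets_with[of ?n k] assms upper_half_sum_odd[of k] by simp
  finally have card: "card ?F = 2 ^ (2 * k) + (2 * k choose (k - 1))" .
  have "union_intersecting 1 2 ?F"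
  proof (rule union_intersecting_one_twoI[of _ ?n])
    fix A B assume "A \<in> ?F" "B \<in> ?F" "A \<inter> B = {}"
    then show "card A + card B = ?n"
      using card_disjoint_le(1)[of A ?n B] by auto
  qed auto
  then show "2 ^ (2 * k) + (2 * k choose (k - 1)) \<le> max_union_intersecting ?n 1 2"
    using max_union_intersecting_ge[of ?F ?n 1 2] unfolding card by auto
qed

text \<open>The upper bound for (1,3) coincides with the value already attained for (1,2).\<close>

lemma max_one_three_even:
  assumes "m \<ge> 2"
  shows "max_union_intersecting (2 * m) 1 3 = (\<Sum>i = m..2 * m. 2 * m choose i)"
proof (rule antisym)
  have "(\<Sum>i = m..2 * m. 2 * m choose i) = 2 ^ (2 * m - 1) + ((2 * m - 1) choose (m - 1))"
    using upper_half_sum_even[of m] central_binomial_even[of m] assms by (simp add: power_eq_if)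
  moreover have "(2 * m - 1) div 2 = m - 1"
    using assms by simp
  ultimately show "max_union_intersecting (2 * m) 1 3 \<le> (\<Sum>i = m..2 * m. 2 * m choose i)"
    using card_one_three_le[of "2 * m"] assms by (intro max_union_intersecting_le) auto
  show "(\<Sum>i = m..2 * m. 2 * m choose i) \<le> max_union_intersecting (2 * m) 1 3"
    unfolding max_one_two_even[OF assms, symmetric] by (rule max_union_intersecting_mono) auto
qed

lemma max_one_three_odd:
  assumes "k \<ge> 1"
  shows "max_union_intersecting (2 * k + 1) 1 3 = 2 ^ (2 * k) + (2 * k choose k)"
proof (rule antisym)
  show "max_union_intersecting (2 * k + 1) 1 3 \<le> 2 ^ (2 * k) + (2 * k choose k)"
    using card_one_three_le[of "2 * k + 1"] assms by (intro max_union_intersecting_le) auto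
  let ?n = "2 * k + 1"
  let ?S = "{1..?n}"
  \<comment> \<open>Two disjoint \<open>k\<close>-sets avoiding 1 together miss only the point 1.
    Hence a member can be disjoint only from its complement and from its complement without
    1.\<close>
  let ?E = "{A. A \<subseteq> ?S \<and> card A = k \<and> 1 \<notin> A}"
  let ?F = "{A. A \<subseteq> ?S \<and> Suc k \<le> card A} \<union> ?E"
  have "card ?F = (\<Sum>i = Suc k..?n. ?n choose i) + card ?E"
    by (rule card_large_subsets_extended) auto
  also have "\<dots> = 2 ^ (2 * k) + (2 * k choose k)"
    using card_subsets_without[of ?n k] assms upper_half_sum_odd[of k] by simp
  finally have card: "card ?F = 2 ^ (2 * k) + (2 * k choose k)" .
  have "union_intersecting 1 3 ?F"
  proof (rule union_intersecting_oneI)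
    show "finite ?F"
      by (rule finite_subset[of _ "Pow ?S"]) auto
    fix A assume A: "A \<in> ?F"
    have "B \<in> {?S - A, ?S - A - {1}}" if B: "B \<in> ?F" "A \<inter> B = {}" for B
    proof (cases "card A + card B = ?n")
      case True
      then show ?thesis
        using card_disjoint_le(2)[of A ?n B] A B by auto
    next
      case False
      then have "A \<in> ?E" "B \<in> ?E"
        using card_disjoint_le(1)[of A ?n B] A B by auto
      then have E: "A \<subseteq> ?S" "card A = k" "1 \<notin> A" "B \<subseteq> ?S" "card B = k" "1 \<notin> B"
        by auto
      then have "B \<subseteq> ?S - A - {1}"
        using B(2) by auto
      moreover have "card (?S - A) = k + 1"
        using E finite_subset[OF E(1)] by (subst card_Diff_subset) auto
      then have "card (?S - A - {1}) = card B"
        using E by (subst card_Diff_singleton) auto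
      ultimately have "B = ?S - A - {1}"
        by (intro card_subset_eq) auto
      then show ?thesis
        by simp
    qed
    then have "card {B \<in> ?F. A \<inter> B = {}} \<le> card {?S - A, ?S - A - {1}}"
      by (intro card_mono) auto
    also have "\<dots> < 3"
      by (simp add: card_insert_if)
    finally show "card {B \<in> ?F. A \<inter> B = {}} < 3" .
  qed
  then show "2 ^ (2 * k) + (2 * k choose k) \<le> max_union_intersecting ?n 1 3"
    using max_union_intersecting_ge[of ?F ?n 1 3] unfolding card by auto
qed

lemma card_Un_distinct_ge:
  assumes "finite A" "finite B" "A \<noteq> B" "p \<le> card A" "p \<le> card B"
  shows "Suc p \<le> card (A \<union> B)"
proof (rule ccontr)
  assume "\<not> ?thesis"
  then have le: "card (A \<union> B) \<le> p"
    by simp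
  have "A = A \<union> B" "B = A \<union> B"
    by (rule card_seteq; use assms le in auto)+
  then show False
    using assms(3) by simp
qed

lemma union_intersecting_two_twoI:
  assumes "\<And>A B C D. {A, B, C, D} \<subseteq> F \<Longrightarrow> A \<noteq> B \<Longrightarrow> C \<noteq> D \<Longrightarrow> (A \<union> B) \<inter> (C \<union> D) \<noteq> {}"
  shows "union_intersecting 2 2 F"
  unfolding union_intersecting_iff
proof (intro allI impI)
  fix X Y
  assume *: "X \<subseteq> F \<and> Y \<subseteq> F \<and> finite X \<and> finite Y \<and> card X = 2 \<and> card Y = 2 \<and> X \<inter> Y = {}"
  then obtain A B C D where "X = {A, B}" "A \<noteq> B" "Y = {C, D}" "C \<noteq> D"
    by (auto simp: card_2_iff)
  then show "\<Union>X \<inter> \<Union>Y \<noteq> {}"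
    using assms[of A B C D] * by simp
qed

text \<open>Sets of size \<open>k\<close> are allowed: two different members have a union of at
  least \<open>k + 1\<close> elements, and two disjoint unions of that size do not fit.\<close>

lemma max_two_two_odd:
  assumes "k \<ge> 1"
  shows "max_union_intersecting (2 * k + 1) 2 2 = 2 ^ (2 * k) + ((2 * k + 1) choose k)"
proof (rule antisym)
  show "max_union_intersecting (2 * k + 1) 2 2 \<le> 2 ^ (2 * k) + ((2 * k + 1) choose k)"
    using card_two_two_le_odd[OF assms] by (intro max_union_intersecting_le) auto
  let ?n = "2 * k + 1"
  let ?F = "{A. A \<subseteq> {1..?n} \<and> k \<le> card A}"
  have card: "card ?F = 2 ^ (2 * k) + (?n choose k)"
    unfolding card_large_subsets using upper_half_sum_odd[of k] sum.atLeast_Suc_atMost[of k ?n "\<lambda>i. ?n choose i"]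
    by simp
  have "union_intersecting 2 2 ?F"
  proof (rule union_intersecting_two_twoI, rule notI)
    fix A B C D
    assume *: "{A, B, C, D} \<subseteq> ?F" "A \<noteq> B" "C \<noteq> D" "(A \<union> B) \<inter> (C \<union> D) = {}"
    then have "Suc k \<le> card (A \<union> B)" "Suc k \<le> card (C \<union> D)"
      by (auto intro!: card_Un_distinct_ge intro: finite_subset)
    then show False
      using card_disjoint_le(1)[of "A \<union> B" ?n "C \<union> D"] * by auto
  qed
  then show "2 ^ (2 * k) + (?n choose k) \<le> max_union_intersecting ?n 2 2"
    using max_union_intersecting_ge[of ?F ?n 2 2] unfolding card by auto
qed

lemma max_two_two_even:
  assumes "m \<ge> 2"
  shows "max_union_intersecting (2 * m) 2 2 = ((2 * m - 1) choose (m - 2)) + (\<Sum>i = m..2 * m. 2 * m choose i)"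
    (is "_ = ?r") and "2 * max_union_intersecting (2 * m) 2 2 = 2 ^ (2 * m) + 2 * (2 * m choose (m - 1))"
proof -
  let ?n = "2 * m"
  have "?n choose (m - 1) = ((?n - 1) choose (m - 2)) + ((?n - 1) choose (m - 1))"
    using assms choose_reduce_nat[of ?n "m - 1"] by (simp add: numeral_2_eq_2)
  then have r: "2 * ?r = 2 ^ ?n + 2 * (?n choose (m - 1))"
    using upper_half_sum_even[of m] central_binomial_even[of m] assms by simp
  show eq: "max_union_intersecting ?n 2 2 = ?r"
  proof (rule antisym)
    show "max_union_intersecting ?n 2 2 \<le> ?r"
    proof (rule max_union_intersecting_le)
      fix F assume "F \<subseteq> Pow {1..?n}" "union_intersecting 2 2 F"
      from card_two_two_le_even[OF assms this] have "2 * card F \<le> 2 * ?r"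
        unfolding r .
      then show "card F \<le> ?r"
        by simp
    qed simp
    \<comment> \<open>Two different members have a union of at least \<open>m\<close> elements; if
      it has exactly \<open>m\<close>, one of them is an \<open>(m - 1)\<close>-set and contributes
      the point 1. Two disjoint unions would both have exactly \<open>m\<close> elements and so
      share 1.\<close>
    let ?E = "{A. A \<subseteq> {1..?n} \<and> card A = m - 1 \<and> 1 \<in> A}"
    let ?F = "{A. A \<subseteq> {1..?n} \<and> m \<le> card A} \<union> ?E"
    have "card ?F = (\<Sum>i = m..?n. ?n choose i) + card ?E"
      using assms by (intro card_large_subsets_extended) auto
    also have "\<dots> = ?r"
      using card_subsets_with[of ?n "m - 1"] assms by (simp add: numeral_2_eq_2)
    finally have card: "card ?F = ?r" .
    have union: "m \<le> card (A \<union> B) \<and> (card (A \<union> B) = m \<longrightarrow> 1 \<in> A \<union> B)"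
      if "A \<in> ?F" "B \<in> ?F" "A \<noteq> B" for A B
    proof -
      have fin: "finite A" "finite B"
        using that by (auto intro: finite_subset)
      have "Suc (m - 1) \<le> card (A \<union> B)"
        using that by (intro card_Un_distinct_ge fin) auto
      moreover have "m < card (A \<union> B)" if "m \<le> card A" "m \<le> card B"
        using card_Un_distinct_ge[OF fin \<open>A \<noteq> B\<close> that] by simp
      ultimately show ?thesis
        using that assms by auto
    qed
    have "union_intersecting 2 2 ?F"
    proof (rule union_intersecting_two_twoI, rule notI)
      fix A B C D
      assume *: "{A, B, C, D} \<subseteq> ?F" "A \<noteq> B" "C \<noteq> D" "(A \<union> B) \<inter> (C \<union> D) = {}"
      then have "card (A \<union> B) + card (C \<union> D) \<le> ?n"
        by (intro card_disjoint_le(1)) auto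
      moreover have "m \<le> card (A \<union> B)" "card (A \<union> B) = m \<longrightarrow> 1 \<in> A \<union> B"
          "m \<le> card (C \<union> D)" "card (C \<union> D) = m \<longrightarrow> 1 \<in> C \<union> D"
        using union[of A B] union[of C D] * by blast+
      ultimately have "1 \<in> A \<union> B" "1 \<in> C \<union> D"
        by simp_all
      then show False
        using *(4) by blast
    qed
    then show "?r \<le> max_union_intersecting ?n 2 2"
      using max_union_intersecting_ge[of ?F ?n 2 2] unfolding card by auto
  qed
  show "2 * max_union_intersecting ?n 2 2 = 2 ^ ?n + 2 * (?n choose (m - 1))"
    unfolding eq by (rule r)
qed

section \<open>General lower bounds and error terms\<close>

text \<open>By monotonicity the value for (1,3) suffices. For \<open>n = 2 * k + 1\<close> its
  excess over \<open>2 ^ (n - 1)\<close> is the larger of the two Pascal summands of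
  \<open>n choose k\<close>.\<close>

lemma half_central_binomial_le:
  assumes "n \<ge> 3" "t \<ge> 3"
  shows "2 ^ (n - 1) + 1 / 2 * real (n choose (n div 2)) \<le> real (max_union_intersecting n 1 t)"
proof -
  have "2 ^ n + (n choose (n div 2)) \<le> 2 * max_union_intersecting n 1 3"
  proof (cases "even n")
    case True
    then obtain m where n: "n = 2 * m"
      by (elim evenE)
    then have m: "m \<ge> 2"
      using assms(1) by simp
    show ?thesis
      unfolding n max_one_three_even[OF m] upper_half_sum_even by simp
  next
    case False
    then obtain k where k: "n = 2 * k + 1"
      by (elim oddE)
    then have "k \<ge> 1" "n div 2 = k" "n - 1 = 2 * k"
      using assms(1) by simp_all
    then have "n choose (n div 2) = (2 * k choose (k - 1)) + (2 * k choose k)"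
      using choose_reduce_nat[of n k] assms(1) by simp
    then have "n choose (n div 2) \<le> 2 * (2 * k choose k)"
      using binomial_maximum'[of k "k - 1"] by linarith
    moreover have "max_union_intersecting n 1 3 = 2 ^ (2 * k) + (2 * k choose k)"
      unfolding k by (rule max_one_three_odd) fact
    moreover have "(2::nat) ^ n = 2 * 2 ^ (2 * k)"
      unfolding k by simp
    ultimately show ?thesis
      by linarith
  qed
  also have "\<dots> \<le> 2 * max_union_intersecting n 1 t"
    using max_union_intersecting_mono[of 1 1 3 t n] assms(2) by simp
  finally have "real (2 ^ n + (n choose (n div 2))) \<le> real (2 * max_union_intersecting n 1 t)"
    by (simp only: of_nat_le_iff)
  moreover have "(2::real) ^ n = 2 * 2 ^ (n - 1)"
    using assms(1) by (simp add: power_eq_if)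
  ultimately show ?thesis
    by simp
qed

text \<open>By monotonicity the value for (2,2) suffices. For \<open>n = 2 * m\<close> its excess is
  \<open>n choose (m - 1)\<close>, and \<open>n / (n + 2)\<close> is the ratio
  \<open>m / (m + 1)\<close> of this to the central coefficient; for odd \<open>n\<close> the excess
  is the full central coefficient.\<close>

lemma central_binomial_fraction_le:
  assumes "n \<ge> 3" "s \<ge> 2" "t \<ge> 2"
  shows "2 ^ (n - 1) + real (n choose (n div 2)) * (real n / (real n + 2)) \<le> real (max_union_intersecting n s t)"
proof -
  have pow: "(2::real) ^ n = 2 * 2 ^ (n - 1)"
    using assms(1) by (simp add: power_eq_if)
  have "2 ^ (n - 1) + real (n choose (n div 2)) * (real n / (real n + 2)) \<le> real (max_union_intersecting n 2 2)"
  proof (cases "even n")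
    case True
    then obtain m where n: "n = 2 * m"
      by (elim evenE)
    then have m: "m \<ge> 2"
      using assms(1) by simp
    have "real ((m + 1) * (n choose (m - 1))) = real (m * (n choose m))"
      unfolding n using m by (subst next_to_central_binomial_even) auto
    then have "real (m + 1) * real (n choose (m - 1)) = real m * real (n choose m)"
      by (simp only: of_nat_mult)
    then have "real (n choose m) * (real m / real (m + 1)) = real (n choose (m - 1))"
      by (simp add: field_simps)
    moreover have "real n / (real n + 2) = real m / real (m + 1)"
      by (simp add: n field_simps)
    ultimately have "real (n choose m) * (real n / (real n + 2)) = real (n choose (m - 1))"
      by (simp only:)
    moreover have "real (2 * max_union_intersecting n 2 2) = real (2 ^ n + 2 * (n choose (m - 1)))"
      unfolding n by (simp only: max_two_two_even(2)[OF m])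
    moreover have "n div 2 = m"
      by (simp add: n)
    ultimately show ?thesis
      using pow by simp
  next
    case False
    then obtain k where k: "n = 2 * k + 1"
      by (elim oddE)
    have "real (n choose k) * (real n / (real n + 2)) \<le> real (n choose k) * 1"
      by (intro mult_left_mono) auto
    moreover have "max_union_intersecting n 2 2 = 2 ^ (2 * k) + (n choose k)"
      unfolding k using assms(1) k by (intro max_two_two_odd) simp
    moreover have "n div 2 = k" "n - 1 = 2 * k"
      using k by simp_all
    ultimately show ?thesis
      by simp
  qed
  also have "\<dots> \<le> real (max_union_intersecting n s t)"
    using max_union_intersecting_mono[of 2 s 2 t n] assms by simp
  finally show ?thesis .
qed

lemma union_intersecting_one_error_term:
  assumes "t \<ge> 2"
  shows "\<exists>h :: nat \<Rightarrow> real. h \<in> O(\<lambda>n. 1 / real n ^ 2) \<and> (\<forall>n. real (max_union_intersecting n 1 t) \<le>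
     2 ^ (n - 1) + real (n choose (n div 2)) * (1 / 2 + (real t - 2) / real n + h n))"
proof -
  from eventually_union_intersecting_one_le[OF assms] obtain K
    where "\<forall>\<^sub>F n in at_top. real (max_union_intersecting n 1 t)
     \<le> 2 ^ (n - 1) + real (n choose (n div 2)) * (1 / 2 + (real t - 2) / real n + K / real n ^ 2)"
    by blast
  then show ?thesis
    by (rule obtain_error_term[rotated]) simp
qed

text \<open>The bound with \<open>s + t - 4\<close> is weakened here to the one with
  \<open>t + s - 3\<close>.\<close>

lemma union_intersecting_error_term:
  assumes "s \<ge> 2" "t \<ge> 2"
  shows "\<exists>h :: nat \<Rightarrow> real. h \<in> O(\<lambda>n. 1 / real n ^ 2) \<and> (\<forall>n. real (max_union_intersecting n s t) \<le>
     2 ^ (n - 1) + real (n choose (n div 2)) * (1 + (real t + real s - 3) / real n + h n))"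
proof -
  from eventually_union_intersecting_le[OF assms] obtain K
    where "\<forall>\<^sub>F n in at_top. real (max_union_intersecting n s t)
     \<le> 2 ^ (n - 1) + real (n choose (n div 2)) * (1 + (real s + real t - 4) / real n + K / real n ^ 2)"
    by blast
  then have "\<forall>\<^sub>F n in at_top. real (max_union_intersecting n s t)
     \<le> 2 ^ (n - 1) + real (n choose (n div 2)) * (1 + (real t + real s - 3) / real n + K / real n ^ 2)"
  proof eventually_elim
    case (elim n)
    have "(real s + real t - 4) / real n \<le> (real t + real s - 3) / real n"
      by (intro divide_right_mono) auto
    then have "real (n choose (n div 2)) * (1 + (real s + real t - 4) / real n + K / real n ^ 2)
       \<le> real (n choose (n div 2)) * (1 + (real t + real s - 3) / real n + K / real n ^ 2)"
      by (intro mult_left_mono) auto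
    with elim show ?case
      by (rule order.trans[OF _ add_left_mono])
  qed
  then show ?thesis
    by (rule obtain_error_term[rotated]) simp
qed

theorem theorem3p1:
  fixes f :: "nat \<Rightarrow> nat \<Rightarrow> nat \<Rightarrow> nat"
  defines "f \<equiv> max_union_intersecting"
  shows
    "(\<forall>n\<ge>3. f n 1 1 = 2 ^ (n - 1))
   \<and> (\<forall>n\<ge>3. f n 1 2 =
        (if even n then (\<Sum>i = n div 2..n. n choose i)
         else ((n - 1) choose ((n - 3) div 2)) + (\<Sum>i = (n + 1) div 2..n. n choose i)))
   \<and> (\<forall>n\<ge>3. f n 2 2 =
        (if odd n then (\<Sum>i = (n - 1) div 2..n. n choose i)
         else ((n - 1) choose (n div 2 - 2)) + (\<Sum>i = n div 2..n. n choose i)))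
   \<and> (\<forall>n\<ge>3. f n 1 3 =
        (if even n then (\<Sum>i = n div 2..n. n choose i)
         else ((n - 1) choose ((n - 1) div 2)) + (\<Sum>i = (n + 1) div 2..n. n choose i)))
   \<and> (\<forall>t\<ge>4.
        (\<forall>n\<ge>3. 2 ^ (n - 1) + 1 / 2 * real (n choose (n div 2)) \<le> real (f n 1 t)) \<and>
        (\<exists>h :: nat \<Rightarrow> real. h \<in> O(\<lambda>n. 1 / real n ^ 2) \<and>
           (\<forall>n\<ge>3. real (f n 1 t) \<le>
              2 ^ (n - 1) + real (n choose (n div 2)) * (1 / 2 + (real t - 2) / real n + h n))))
   \<and> (\<forall>s\<ge>2. \<forall>t\<ge>3.
        (\<forall>n\<ge>3. 2 ^ (n - 1) + real (n choose (n div 2)) * (real n / (real n + 2)) \<le> real (f n s t)) \<and>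
        (\<exists>h :: nat \<Rightarrow> real. h \<in> O(\<lambda>n. 1 / real n ^ 2) \<and>
           (\<forall>n\<ge>3. real (f n s t) \<le>
              2 ^ (n - 1) + real (n choose (n div 2)) * (1 + (real t + real s - 3) / real n + h n))))"
proof (intro conjI allI impI)
  fix n :: nat assume n: "n \<ge> 3"
  show "f n 1 1 = 2 ^ (n - 1)"
    unfolding f_def using n by (intro max_one_one) simp
  show "f n 1 2 = (if even n then (\<Sum>i = n div 2..n. n choose i)
      else ((n - 1) choose ((n - 3) div 2)) + (\<Sum>i = (n + 1) div 2..n. n choose i))"
  proof (cases "even n")
    case True
    then obtain m where m: "n = 2 * m"
      by (elim evenE)
    then have "m \<ge> 2"
      using n by simp
    then show ?thesis
      unfolding f_def m by (subst max_one_two_even) auto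
  next
    case False
    then obtain k where k: "n = 2 * k + 1"
      by (elim oddE)
    then have "k \<ge> 1"
      using n by simp
    have div: "(n + 1) div 2 = Suc k" "(n - 3) div 2 = k - 1" "n - 1 = 2 * k"
      using k by simp_all
    have sum: "(\<Sum>i = Suc k..n. n choose i) = 2 ^ (2 * k)"
      unfolding k by (rule upper_half_sum_odd)
    have "max_union_intersecting n 1 2 = 2 ^ (2 * k) + (2 * k choose (k - 1))"
      unfolding k by (rule max_one_two_odd) fact
    then show ?thesis
      using False by (simp only: f_def sum div if_False)
  qed
  show "f n 2 2 = (if odd n then (\<Sum>i = (n - 1) div 2..n. n choose i)
      else ((n - 1) choose (n div 2 - 2)) + (\<Sum>i = n div 2..n. n choose i))"
  proof (cases "even n")
    case True
    then obtain m where m: "n = 2 * m"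
      by (elim evenE)
    then have "m \<ge> 2"
      using n by simp
    then show ?thesis
      unfolding f_def m by (subst max_two_two_even(1)) auto
  next
    case False
    then obtain k where k: "n = 2 * k + 1"
      by (elim oddE)
    then have "k \<ge> 1"
      using n by simp
    have div: "(n - 1) div 2 = k"
      using k by simp
    have sum: "(\<Sum>i = k..n. n choose i) = 2 ^ (2 * k) + (n choose k)"
      using upper_half_sum_odd[of k] sum.atLeast_Suc_atMost[of k n "\<lambda>i. n choose i"] k by simp
    have "max_union_intersecting n 2 2 = 2 ^ (2 * k) + (n choose k)"
      unfolding k by (rule max_two_two_odd) fact
    then show ?thesis
      using False by (simp only: f_def sum div if_True not_False_eq_True)
  qed
  show "f n 1 3 = (if even n then (\<Sum>i = n div 2..n. n choose i)
      else ((n - 1) choose ((n - 1) div 2)) + (\<Sum>i = (n + 1) div 2..n. n choose i))"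
  proof (cases "even n")
    case True
    then obtain m where m: "n = 2 * m"
      by (elim evenE)
    then have "m \<ge> 2"
      using n by simp
    then show ?thesis
      unfolding f_def m by (subst max_one_three_even) auto
  next
    case False
    then obtain k where k: "n = 2 * k + 1"
      by (elim oddE)
    then have "k \<ge> 1"
      using n by simp
    have div: "(n + 1) div 2 = Suc k" "2 * k div 2 = k" "n - 1 = 2 * k"
      using k by simp_all
    have sum: "(\<Sum>i = Suc k..n. n choose i) = 2 ^ (2 * k)"
      unfolding k by (rule upper_half_sum_odd)
    have "max_union_intersecting n 1 3 = 2 ^ (2 * k) + (2 * k choose k)"
      unfolding k by (rule max_one_three_odd) fact
    then show ?thesis
      using False by (simp only: f_def sum div if_False)
  qed
next
  fix t n :: nat assume "t \<ge> 4" "n \<ge> 3"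
  then show "2 ^ (n - 1) + 1 / 2 * real (n choose (n div 2)) \<le> real (f n 1 t)"
    unfolding f_def by (intro half_central_binomial_le) auto
next
  fix t :: nat assume "t \<ge> 4"
  then show "\<exists>h :: nat \<Rightarrow> real. h \<in> O(\<lambda>n. 1 / real n ^ 2) \<and>
      (\<forall>n\<ge>3. real (f n 1 t) \<le>
         2 ^ (n - 1) + real (n choose (n div 2)) * (1 / 2 + (real t - 2) / real n + h n))"
    unfolding f_def using union_intersecting_one_error_term[of t] by auto
next
  fix s t n :: nat assume "s \<ge> 2" "t \<ge> 3" "n \<ge> 3"
  then show "2 ^ (n - 1) + real (n choose (n div 2)) * (real n / (real n + 2)) \<le> real (f n s t)"
    unfolding f_def by (intro central_binomial_fraction_le) auto
next
  fix s t :: nat assume "s \<ge> 2" "t \<ge> 3"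
  then show "\<exists>h :: nat \<Rightarrow> real. h \<in> O(\<lambda>n. 1 / real n ^ 2) \<and>
      (\<forall>n\<ge>3. real (f n s t) \<le>
         2 ^ (n - 1) + real (n choose (n div 2)) * (1 + (real t + real s - 3) / real n + h n))"
    unfolding f_def using union_intersecting_error_term[of s t] by auto
qed

end
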